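(* If $i=1,2,\ldots$, then (1) $L_{i+1}$ commutes with $\mathcal{A}_{i+\frac12}(z)$, and $\sigma_{i+1}$ commutes with $\mathcal{A}_{i-\frac12}(z)$; (2) $L_{i+\frac12}$ commutes with $\mathcal{A}_i(z)$, and $\sigma_{i+\frac12}$ commutes with $\mathcal{A}_{i-1}(z)$. Consequently, the family of elements $(L_i,L_{i+\frac12}: i=0,1,\ldots)$ is pairwise commutative.
   Context: Partition algebras. For an integer $k\ge1$ let $A_k$ be the set of all set partitions of $\{1,\ldots,k,1',\ldots,k'\}$, and let $A_{k-\frac12}\subseteq A_k$ be the subset of those in which $k$ and $k'$ lie in the same block. A partition is drawn as a graph with top vertices $1,\ldots,k$ and bottom vertices $1',\ldots,k'$, whose connected components are the blocks. For $\rho_1,\rho_2\in A_k$, $\rho_1\circ\rho_2\in A_k$ is obtained by placing $\rho_1$ above $\rho_2$, identifying the bottom row of $\rho_1$ with the top row of $\rho_2$, and deleting components contained entirely in the middle row. Let $R=\mathbb{Z}[z]$, $z$ an indeterminate. $\mathcal{A}_k(z)$ is the free $R$-module on $A_k$ with product $\rho_1\rho_2=z^{\ell}\,\rho_1\circ\rho_2$, where $\ell$ is the number of components deleted from the middle row; $\mathcal{A}_{k-\frac12}(z)$ is the subalgebra generated by $A_{k-\frac12}$, and $\mathcal{A}_0(z)=R$. Adding the block $\{k+1,(k+1)'\}$ embeds $\mathcal{A}_k(z)$ in $\mathcal{A}_{k+\frac12}(z)\subseteq\mathcal{A}_{k+1}(z)$; all identities are understood in $\mathcal{A}_k(z)$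 for $k$ large enough to contain the elements involved. Elements: $s_i$ ($i\ge1$) has blocks $\{i,(i+1)'\},\{i+1,i'\}$ and $\{m,m'\}$ for $m\ne i,i+1$; $p_j$ ($j\ge1$) has blocks $\{j\},\{j'\}$ and $\{m,m'\}$ for $m\ne j$; $p_{i+\frac12}$ ($i\ge1$) has blocks $\{i,i+1,i',(i+1)'\}$ and $\{m,m'\}$ for $m\neq i,i+1$. Recursive definitions. $L_0=0$, $L_1=p_1$, $\sigma_1=1$, $\sigma_2=s_1$, and $L_{i+1}=-s_iL_ip_{i+\frac12}-p_{i+\frac12}L_is_i+p_{i+\frac12}L_ip_{i+1}p_{i+\frac12}+s_iL_is_i+\sigma_{i+1}$ for $i\ge1$, where for $i\ge2$ $\sigma_{i+1}=s_{i-1}s_i\sigma_is_is_{i-1}+s_ip_{i-\frac12}L_{i-1}s_ip_{i-\frac12}s_i+p_{i-\frac12}L_{i-1}s_ip_{i-\frac12}-s_ip_{i-\frac12}L_{i-1}s_{i-1}p_{i+\frac12}p_ip_{i-\frac12}-p_{i-\frac12}p_ip_{i+\frac12}s_{i-1}L_{i-1}p_{i-\frac12}s_i.$ Also $L_{\frac12}=0$, $\sigma_{\frac12}=1$, $\sigma_{1+\frac12}=1$, and $L_{i+\frac12}=-L_ip_{i+\frac12}-p_{i+\frac12}L_i+p_{i+\frac12}L_ip_ip_{i+\frac12}+s_iL_{i-\frac12}s_i+\sigma_{i+\frac12}$ for $i\ge1$, where for $i\ge2$ $\sigma_{i+\frac12}=s_{i-1}s_i\sigma_{i-\frac12}s_is_{i-1}+p_{i-\frac12}L_{i-1}s_ip_{i-\frac12}s_i+s_ip_{i-\frac12}L_{i-1}s_ip_{i-\frac12}-p_{i-\frac12}L_{i-1}s_{i-1}p_{i+\frac12}p_ip_{i-\frac12}-s_ip_{i-\frac12}p_ip_{i+\frac12}s_{i-1}L_{i-1}p_{i-\frac12}s_i.$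 *)

theory Defs
  imports
    Complex_Main
    "HOL-Library.Disjoint_Sets"
    "HOL-Library.Poly_Mapping"
    "HOL-Computational_Algebra.Polynomial"
begin

section \<open>Diagrams and their composition\<close>

datatype vertex = Top nat | Bot nat

type_synonym diagram = "vertex set set"

definition vertices :: "nat \<Rightarrow> vertex set" where
  "vertices k = Top ` {1..k} \<union> Bot ` {1..k}"

text \<open>\<open>diagrams k\<close> is $A_k$ and \<open>half_diagrams k\<close> is $A_{k-\frac12}$ (for $k \ge 1$). Moreover
  \<open>diagrams 0\<close> consists of the empty partition only, so that the free module on it is $R$.\<close>

definition diagrams :: "nat \<Rightarrow> diagram set" where
  "diagrams k = {\<rho>. partition_on (vertices k) \<rho>}"

definition half_diagrams :: "nat \<Rightarrow> diagram set" where
  "half_diagrams k = {\<rho> \<in> diagrams k. \<exists>B \<in> \<rho>. Top k \<in> B \<and> Bot k \<in> B}"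

text \<open>Composition is computed in the stacked graph with three rows: \<open>\<rho>1\<close> occupies the upper and
  the middle row, \<open>\<rho>2\<close> the middle and the lower row, and two vertices are adjacent if they
  lie in a common block of \<open>\<rho>1\<close> or of \<open>\<rho>2\<close>.\<close>

datatype stacked = Upper nat | Middle nat | Lower nat

fun stack_first :: "vertex \<Rightarrow> stacked" where
  "stack_first (Top m) = Upper m"
| "stack_first (Bot m) = Middle m"

fun stack_second :: "vertex \<Rightarrow> stacked" where
  "stack_second (Top m) = Middle m"
| "stack_second (Bot m) = Lower m"

fun stack_outer :: "vertex \<Rightarrow> stacked" where
  "stack_outer (Top m) = Upper m"
| "stack_outer (Bot m) = Lower m"

definition stacked_blocks :: "diagram \<Rightarrow> diagram \<Rightarrow> stacked set set" where
  "stacked_blocks \<rho>1 \<rho>2 = (`) stack_first ` \<rho>1 \<union> (`) stack_second ` \<rho>2"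

definition components :: "diagram \<Rightarrow> diagram \<Rightarrow> stacked set set" where
  "components \<rho>1 \<rho>2 =
     \<Union> (stacked_blocks \<rho>1 \<rho>2) // {(x, y). \<exists>B \<in> stacked_blocks \<rho>1 \<rho>2. x \<in> B \<and> y \<in> B}\<^sup>*"

definition middle_components :: "diagram \<Rightarrow> diagram \<Rightarrow> stacked set set" where
  "middle_components \<rho>1 \<rho>2 = {C \<in> components \<rho>1 \<rho>2. C \<subseteq> range Middle}"

definition compose :: "diagram \<Rightarrow> diagram \<Rightarrow> diagram" where
  "compose \<rho>1 \<rho>2 = (-`) stack_outer ` (components \<rho>1 \<rho>2 - middle_components \<rho>1 \<rho>2)"


section \<open>The partition algebras\<close>

text \<open>Coefficients lie in $R = \mathbb{Z}[z]$, and an element is a finitely supported function from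
  diagrams to $R$. The multiplication does not refer to $k$; it is only used on elements
  of \<open>partition_algebra k\<close> for a common $k$.\<close>

type_synonym element = "diagram \<Rightarrow>\<^sub>0 int poly"

definition z :: "int poly" where
  "z = monom 1 1"

definition basis :: "diagram \<Rightarrow> element" where
  "basis \<rho> = Poly_Mapping.single \<rho> 1"

definition scale :: "int poly \<Rightarrow> element \<Rightarrow> element" where
  "scale r x = Poly_Mapping.map (\<lambda>c. r * c) x"

definition mult :: "element \<Rightarrow> element \<Rightarrow> element"  (infixl \<open>\<cdot>\<close> 70) where
  "x \<cdot> y = (\<Sum>\<rho>1 \<in> Poly_Mapping.keys x. \<Sum>\<rho>2 \<in> Poly_Mapping.keys y.
     scale (Poly_Mapping.lookup x \<rho>1 * Poly_Mapping.lookup y \<rho>2 * z ^ card (middle_components \<rho>1 \<rho>2))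
       (basis (compose \<rho>1 \<rho>2)))"

definition partition_algebra :: "nat \<Rightarrow> element set" where
  "partition_algebra k = {x. Poly_Mapping.keys x \<subseteq> diagrams k}"

text \<open>\<open>half_partition_algebra k\<close> is $\mathcal{A}_{k-\frac12}(z)$, for $k \ge 1$. As the generators contain
  the identity diagram, it does not matter whether subalgebras are required to be unital.\<close>

inductive_set half_partition_algebra :: "nat \<Rightarrow> element set" for k :: nat where
  generator: "\<rho> \<in> half_diagrams k \<Longrightarrow> basis \<rho> \<in> half_partition_algebra k"
| add: "x \<in> half_partition_algebra k \<Longrightarrow> y \<in> half_partition_algebra k
    \<Longrightarrow> x + y \<in> half_partition_algebra k"
| scale: "x \<in> half_partition_algebra k \<Longrightarrow> scale r x \<in> half_partition_algebra k"
| mult: "x \<in> half_partition_algebra k \<Longrightarrow> y \<in> half_partition_algebra k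
    \<Longrightarrow> x \<cdot> y \<in> half_partition_algebra k"

definition strand :: "nat \<Rightarrow> vertex set" where
  "strand m = {Top m, Bot m}"

text \<open>The embedding of $\mathcal{A}_j(z)$ into $\mathcal{A}_k(z)$ for $j \le k$, which adds the
  blocks $\{m, m'\}$ for $j < m \le k$.\<close>

definition embed :: "nat \<Rightarrow> nat \<Rightarrow> element \<Rightarrow> element" where
  "embed j k x = (\<Sum>\<rho> \<in> Poly_Mapping.keys x. scale (Poly_Mapping.lookup x \<rho>) (basis (\<rho> \<union> strand ` {j<..k})))"


section \<open>Generators and the recursively defined elements\<close>

text \<open>All of the following are elements of $\mathcal{A}_k(z)$, the first argument being $k$. The
  generator $p_{i+\frac12}$ is \<open>p_half k i\<close>.\<close>

definition unit :: "nat \<Rightarrow> element" where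
  "unit k = basis (strand ` {1..k})"

definition s :: "nat \<Rightarrow> nat \<Rightarrow> element" where
  "s k i = basis ({{Top i, Bot (i + 1)}, {Top (i + 1), Bot i}} \<union> strand ` ({1..k} - {i, i + 1}))"

definition p :: "nat \<Rightarrow> nat \<Rightarrow> element" where
  "p k j = basis ({{Top j}, {Bot j}} \<union> strand ` ({1..k} - {j}))"

definition p_half :: "nat \<Rightarrow> nat \<Rightarrow> element" where
  "p_half k i = basis ({{Top i, Top (i + 1), Bot i, Bot (i + 1)}} \<union> strand ` ({1..k} - {i, i + 1}))"

text \<open>\<open>L k i\<close> is $L_i$ and \<open>\<sigma> k i\<close> is $\sigma_i$, computed in $\mathcal{A}_k(z)$; \<open>L_half k i\<close> is $L_{i+\frac12}$ and
  \<open>\<sigma>_half k i\<close> is $\sigma_{i+\frac12}$. The elements $L_i$, $\sigma_i$ lie in $\mathcal{A}_k(z)$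
  if $i \le k$, and $L_{i+\frac12}$, $\sigma_{i+\frac12}$ if $i + 1 \le k$; other values are meaningless, as is
  \<open>\<sigma> k 0\<close>. The equations are restated below in terms of \<open>i\<close>, \<open>i - 1\<close> and \<open>i + 1\<close>.\<close>

fun L :: "nat \<Rightarrow> nat \<Rightarrow> element" and \<sigma> :: "nat \<Rightarrow> nat \<Rightarrow> element" where
  "L k 0 = 0"
| "L k (Suc 0) = p k 1"
| "L k (Suc (Suc n)) = (let i = Suc n in
     - (s k i \<cdot> L k (Suc n) \<cdot> p_half k i)
     - p_half k i \<cdot> L k (Suc n) \<cdot> s k i
     + p_half k i \<cdot> L k (Suc n) \<cdot> p k (i + 1) \<cdot> p_half k i
     + s k i \<cdot> L k (Suc n) \<cdot> s k i
     + \<sigma> k (Suc (Suc n)))"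
| "\<sigma> k 0 = 0"
| "\<sigma> k (Suc 0) = unit k"
| "\<sigma> k (Suc (Suc 0)) = s k 1"
| "\<sigma> k (Suc (Suc (Suc n))) = (let i = Suc (Suc n) in
       s k (i - 1) \<cdot> s k i \<cdot> \<sigma> k (Suc (Suc n)) \<cdot> s k i \<cdot> s k (i - 1)
     + s k i \<cdot> p_half k (i - 1) \<cdot> L k (Suc n) \<cdot> s k i \<cdot> p_half k (i - 1) \<cdot> s k i
     + p_half k (i - 1) \<cdot> L k (Suc n) \<cdot> s k i \<cdot> p_half k (i - 1)
     - s k i \<cdot> p_half k (i - 1) \<cdot> L k (Suc n) \<cdot> s k (i - 1) \<cdot> p_half k i \<cdot> p k i \<cdot> p_half k (i - 1)
     - p_half k (i - 1) \<cdot> p k i \<cdot> p_half k i \<cdot> s k (i - 1) \<cdot> L k (Suc n) \<cdot> p_half k (i - 1) \<cdot> s k i)"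

fun \<sigma>_half :: "nat \<Rightarrow> nat \<Rightarrow> element" where
  "\<sigma>_half k 0 = unit k"
| "\<sigma>_half k (Suc 0) = unit k"
| "\<sigma>_half k (Suc (Suc n)) = (let i = Suc (Suc n) in
       s k (i - 1) \<cdot> s k i \<cdot> \<sigma>_half k (Suc n) \<cdot> s k i \<cdot> s k (i - 1)
     + p_half k (i - 1) \<cdot> L k (i - 1) \<cdot> s k i \<cdot> p_half k (i - 1) \<cdot> s k i
     + s k i \<cdot> p_half k (i - 1) \<cdot> L k (i - 1) \<cdot> s k i \<cdot> p_half k (i - 1)
     - p_half k (i - 1) \<cdot> L k (i - 1) \<cdot> s k (i - 1) \<cdot> p_half k i \<cdot> p k i \<cdot> p_half k (i - 1)
     - s k i \<cdot> p_half k (i - 1) \<cdot> p k i \<cdot> p_half k i \<cdot> s k (i - 1) \<cdot> L k (i - 1) \<cdot> p_half k (i - 1) \<cdot> s k i)"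

fun L_half :: "nat \<Rightarrow> nat \<Rightarrow> element" where
  "L_half k 0 = 0"
| "L_half k (Suc n) = (let i = Suc n in
     - (L k i \<cdot> p_half k i)
     - p_half k i \<cdot> L k i
     + p_half k i \<cdot> L k i \<cdot> p k i \<cdot> p_half k i
     + s k i \<cdot> L_half k n \<cdot> s k i
     + \<sigma>_half k i)"

lemma L_rec:
  assumes "i \<ge> 1"
  shows "L k (i + 1) =
     - (s k i \<cdot> L k i \<cdot> p_half k i)
     - p_half k i \<cdot> L k i \<cdot> s k i
     + p_half k i \<cdot> L k i \<cdot> p k (i + 1) \<cdot> p_half k i
     + s k i \<cdot> L k i \<cdot> s k i
     + \<sigma> k (i + 1)"
  using assms by (cases i) (simp_all add: Let_def)

lemma \<sigma>_rec:
  assumes "i \<ge> 2"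
  shows "\<sigma> k (i + 1) =
       s k (i - 1) \<cdot> s k i \<cdot> \<sigma> k i \<cdot> s k i \<cdot> s k (i - 1)
     + s k i \<cdot> p_half k (i - 1) \<cdot> L k (i - 1) \<cdot> s k i \<cdot> p_half k (i - 1) \<cdot> s k i
     + p_half k (i - 1) \<cdot> L k (i - 1) \<cdot> s k i \<cdot> p_half k (i - 1)
     - s k i \<cdot> p_half k (i - 1) \<cdot> L k (i - 1) \<cdot> s k (i - 1) \<cdot> p_half k i \<cdot> p k i \<cdot> p_half k (i - 1)
     - p_half k (i - 1) \<cdot> p k i \<cdot> p_half k i \<cdot> s k (i - 1) \<cdot> L k (i - 1) \<cdot> p_half k (i - 1) \<cdot> s k i"
proof -
  obtain n where "i = Suc (Suc n)"
    using assms by (metis add_2_eq_Suc le_Suc_ex)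
  then show ?thesis by (simp add: Let_def)
qed

lemma L_half_rec:
  assumes "i \<ge> 1"
  shows "L_half k i =
     - (L k i \<cdot> p_half k i)
     - p_half k i \<cdot> L k i
     + p_half k i \<cdot> L k i \<cdot> p k i \<cdot> p_half k i
     + s k i \<cdot> L_half k (i - 1) \<cdot> s k i
     + \<sigma>_half k i"
  using assms by (cases i) (simp_all add: Let_def)

lemma \<sigma>_half_rec:
  assumes "i \<ge> 2"
  shows "\<sigma>_half k i =
       s k (i - 1) \<cdot> s k i \<cdot> \<sigma>_half k (i - 1) \<cdot> s k i \<cdot> s k (i - 1)
     + p_half k (i - 1) \<cdot> L k (i - 1) \<cdot> s k i \<cdot> p_half k (i - 1) \<cdot> s k i
     + s k i \<cdot> p_half k (i - 1) \<cdot> L k (i - 1) \<cdot> s k i \<cdot> p_half k (i - 1)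
     - p_half k (i - 1) \<cdot> L k (i - 1) \<cdot> s k (i - 1) \<cdot> p_half k i \<cdot> p k i \<cdot> p_half k (i - 1)
     - s k i \<cdot> p_half k (i - 1) \<cdot> p k i \<cdot> p_half k i \<cdot> s k (i - 1) \<cdot> L k (i - 1) \<cdot> p_half k (i - 1) \<cdot> s k i"
proof -
  obtain n where "i = Suc (Suc n)"
    using assms by (metis add_2_eq_Suc le_Suc_ex)
  then show ?thesis by (simp add: Let_def)
qed

definition commutes :: "element \<Rightarrow> element \<Rightarrow> bool" where
  "commutes x y \<longleftrightarrow> x \<cdot> y = y \<cdot> x"

end

theory Submission
  imports Defs "HOL-Combinatorics.Transposition"
begin

text \<open>The proof specialises $z$ to a natural number $n$ and uses the representation of the partition
  algebra known from Schur--Weyl duality with the symmetric group $S_n$. Let $b$ range over the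
  labellings $\{1,\ldots,k\} \to \{0,\ldots,n-1\}$. A diagram $\rho$ acts on integer functions $f$ of
  labellings by letting $(f\rho)(b)$ be the sum of $f(a)$ over all $a$ such that labelling the top
  row of $\rho$ by $a$ and the bottom row by $b$ gives every block a single label. Stacking
  diagrams then corresponds to composing operators, because a component that is deleted from the
  middle row can be labelled in $n$ ways (\<open>act_mult\<close>). Moreover, an element of the algebra that
  acts as zero for every $n$ is zero (\<open>eq_0_if_act_0\<close>). So two elements commute as soon as their
  operators commute for every $n$ (\<open>commutesI\<close>).

  In this representation the recursively defined elements have closed forms. Write
  $T^m_{c,d}\,b$ (\<open>permute_upto m c d b\<close>) for the result of exchanging the labels $c$ and $d$ in the
  entries $b_1,\ldots,b_m$. Then, for $i \ge 1$,
  \[ (f L_i)(b) = \sum_c f(T^i_{c,b_i}\,b), \qquad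
     (f L_{i+\frac12})(b) = n f(b) - \sum_c f(T^i_{c,b_{i+1}}\,b), \]
  \[ (f \sigma_{i+1})(b) = f(T^{i+1}_{b_i,b_{i+1}}\,b), \qquad
     (f \sigma_{i+\frac12})(b) = f(T^{i-1}_{b_i,b_{i+1}}\,b). \]
  The sums over $c$ are, up to multiples of the identity, differences of class sums of
  transpositions in $S_n$ and in the stabiliser of one label, as one expects of Jucys--Murphy
  elements. The formulas follow by induction from the recursions
  (\<open>L_step\<close>, \<open>L_half_step\<close>, \<open>\<sigma>_step\<close>, \<open>\<sigma>_half_step\<close>): the conjugate of
  the preceding element already acts as required, except where one of the labels to be exchanged
  also occurs in a neighbouring entry, and the remaining terms repair these cases.

  All commutation relations now have one cause. A diagram only records which labels agree, so an
  element of $\mathcal{A}_j(z)$ commutes with every $T^m_{c,d}$ with fixed labels $c$, $d$ and $m \ge j$. It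
  also leaves the entries above $j$ alone, and the entry $j$ too if it comes from
  $\mathcal{A}_{j-\frac12}(z)$. In the closed forms the exchanged labels are
  summation indices or such untouched entries of $b$, so they may be treated as fixed labels
  (\<open>act_permute_sum\<close>, \<open>act_permute_entries\<close>). The elements $L_i$ and $L_{i+\frac12}$ have both
  properties themselves, by their closed forms, which makes the family commutative.\<close>

section \<open>Labellings of stacked diagrams\<close>

definition labellings :: "nat \<Rightarrow> nat \<Rightarrow> (nat \<Rightarrow> nat) set" where
  "labellings n k = {1..k} \<rightarrow>\<^sub>E {..<n}"

definition monochromatic :: "('a \<Rightarrow> 'b) \<Rightarrow> 'a set set \<Rightarrow> bool" where
  "monochromatic f P \<longleftrightarrow> (\<forall>B\<in>P. \<forall>u\<in>B. \<forall>v\<in>B. f u = f v)"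

fun label :: "(nat \<Rightarrow> nat) \<Rightarrow> (nat \<Rightarrow> nat) \<Rightarrow> vertex \<Rightarrow> nat" where
  "label a b (Top m) = a m"
| "label a b (Bot m) = b m"

fun stacked_label :: "(nat \<Rightarrow> nat) \<Rightarrow> (nat \<Rightarrow> nat) \<Rightarrow> (nat \<Rightarrow> nat) \<Rightarrow> stacked \<Rightarrow> nat" where
  "stacked_label a c b (Upper m) = a m"
| "stacked_label a c b (Middle m) = c m"
| "stacked_label a c b (Lower m) = b m"

definition stacked_vertices :: "nat \<Rightarrow> stacked set" where
  "stacked_vertices k = Upper ` {1..k} \<union> Middle ` {1..k} \<union> Lower ` {1..k}"

definition linked :: "diagram \<Rightarrow> diagram \<Rightarrow> (stacked \<times> stacked) set" where
  "linked \<rho>1 \<rho>2 = {(x, y). \<exists>B \<in> stacked_blocks \<rho>1 \<rho>2. x \<in> B \<and> y \<in> B}\<^sup>*"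

lemma components_eq_quotient: "components \<rho>1 \<rho>2 = \<Union> (stacked_blocks \<rho>1 \<rho>2) // linked \<rho>1 \<rho>2"
  by (simp add: components_def linked_def)

lemma finite_labellings [simp]: "finite (labellings n k)"
  by (simp add: labellings_def finite_PiE)

lemma Union_stacked_blocks:
  assumes "\<rho>1 \<in> diagrams k" "\<rho>2 \<in> diagrams k"
  shows "\<Union> (stacked_blocks \<rho>1 \<rho>2) = stacked_vertices k"
proof -
  have "\<Union> (stacked_blocks \<rho>1 \<rho>2) = stack_first ` \<Union> \<rho>1 \<union> stack_second ` \<Union> \<rho>2"
    by (auto simp: stacked_blocks_def)
  moreover have "\<Union> \<rho>1 = vertices k" "\<Union> \<rho>2 = vertices k"
    using assms by (auto simp: diagrams_def partition_on_def)
  ultimately show ?thesis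
    by (simp add: vertices_def stacked_vertices_def image_Un image_image Un_assoc)
qed

lemma linked_refl: "(x, x) \<in> linked \<rho>1 \<rho>2"
  by (simp add: linked_def)

lemma linked_sym: "(x, y) \<in> linked \<rho>1 \<rho>2 \<Longrightarrow> (y, x) \<in> linked \<rho>1 \<rho>2"
  unfolding linked_def by (rule symD[OF sym_rtrancl]) (auto simp: sym_def)

lemma linked_trans: "(x, y) \<in> linked \<rho>1 \<rho>2 \<Longrightarrow> (y, w) \<in> linked \<rho>1 \<rho>2 \<Longrightarrow> (x, w) \<in> linked \<rho>1 \<rho>2"
  unfolding linked_def by (rule rtrancl_trans)

lemma linked_block: "B \<in> stacked_blocks \<rho>1 \<rho>2 \<Longrightarrow> x \<in> B \<Longrightarrow> y \<in> B \<Longrightarrow> (x, y) \<in> linked \<rho>1 \<rho>2"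
  unfolding linked_def by auto

lemma linked_closed:
  "(x, y) \<in> linked \<rho>1 \<rho>2 \<Longrightarrow> x \<in> \<Union> (stacked_blocks \<rho>1 \<rho>2) \<Longrightarrow> y \<in> \<Union> (stacked_blocks \<rho>1 \<rho>2)"
  unfolding linked_def by (induction rule: rtrancl_induct) auto

lemma component_eq_class:
  "C \<in> components \<rho>1 \<rho>2 \<Longrightarrow> x \<in> C \<Longrightarrow> C = linked \<rho>1 \<rho>2 `` {x}"
  unfolding components_eq_quotient by (auto elim!: quotientE intro: linked_trans linked_sym)

lemma class_in_components:
  "\<rho>1 \<in> diagrams k \<Longrightarrow> \<rho>2 \<in> diagrams k \<Longrightarrow> x \<in> stacked_vertices k
    \<Longrightarrow> linked \<rho>1 \<rho>2 `` {x} \<in> components \<rho>1 \<rho>2"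
  unfolding components_eq_quotient by (simp add: Union_stacked_blocks quotientI)

lemma component_subset:
  "\<rho>1 \<in> diagrams k \<Longrightarrow> \<rho>2 \<in> diagrams k \<Longrightarrow> C \<in> components \<rho>1 \<rho>2 \<Longrightarrow> C \<subseteq> stacked_vertices k"
  unfolding components_eq_quotient
  using linked_closed[of _ _ \<rho>1 \<rho>2] by (auto elim!: quotientE simp: Union_stacked_blocks)

lemma finite_components:
  assumes "\<rho>1 \<in> diagrams k" "\<rho>2 \<in> diagrams k"
  shows "finite (components \<rho>1 \<rho>2)"
proof -
  have "components \<rho>1 \<rho>2 \<subseteq> Pow (stacked_vertices k)"
    using component_subset[OF assms] by blast
  moreover have "finite (stacked_vertices k)" by (simp add: stacked_vertices_def)
  ultimately show ?thesis by (meson finite_Pow_iff finite_subset)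
qed

lemma component_nonempty: "C \<in> components \<rho>1 \<rho>2 \<Longrightarrow> C \<noteq> {}"
  unfolding components_eq_quotient by (auto elim!: quotientE intro: linked_refl)

lemma nonmiddle_iff_outer: "C \<subseteq> range Middle \<longleftrightarrow> stack_outer -` C = {}"
proof
  assume "C \<subseteq> range Middle"
  then show "stack_outer -` C = {}"
    by (auto elim!: stack_outer.elims)
next
  assume e: "stack_outer -` C = {}"
  show "C \<subseteq> range Middle"
  proof
    fix x assume "x \<in> C"
    with e have "x \<noteq> stack_outer u" for u by auto
    from this[of "Top _"] this[of "Bot _"] show "x \<in> range Middle"
      by (cases x) auto
  qed
qed

lemma compose_in_diagrams:
  assumes "\<rho>1 \<in> diagrams k" "\<rho>2 \<in> diagrams k"
  shows "compose \<rho>1 \<rho>2 \<in> diagrams k"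
  unfolding diagrams_def mem_Collect_eq
proof (rule partition_onI)
  have outer: "u \<in> vertices k" if "stack_outer u \<in> stacked_vertices k" for u
    using that by (cases u) (auto simp: vertices_def stacked_vertices_def)
  have outer': "stack_outer u \<in> stacked_vertices k" if "u \<in> vertices k" for u
    using that by (auto simp: vertices_def stacked_vertices_def)
  show "\<Union> (compose \<rho>1 \<rho>2) = vertices k"
  proof
    show "\<Union> (compose \<rho>1 \<rho>2) \<subseteq> vertices k"
      using component_subset[OF assms] outer by (auto simp: compose_def)
    show "vertices k \<subseteq> \<Union> (compose \<rho>1 \<rho>2)"
    proof
      fix u assume "u \<in> vertices k"
      then have C: "linked \<rho>1 \<rho>2 `` {stack_outer u} \<in> components \<rho>1 \<rho>2" (is "?C \<in> _")
        using class_in_components[OF assms] outer' by blast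
      have u: "u \<in> stack_outer -` ?C" by (simp add: linked_refl)
      then have "?C \<notin> middle_components \<rho>1 \<rho>2"
        using nonmiddle_iff_outer by (auto simp: middle_components_def)
      with C u show "u \<in> \<Union> (compose \<rho>1 \<rho>2)" unfolding compose_def by blast
    qed
  qed
next
  fix p q assume "p \<in> compose \<rho>1 \<rho>2" "q \<in> compose \<rho>1 \<rho>2" and ne: "p \<noteq> q"
  then obtain C D where CD: "C \<in> components \<rho>1 \<rho>2" "D \<in> components \<rho>1 \<rho>2"
    "p = stack_outer -` C" "q = stack_outer -` D"
    by (auto simp: compose_def)
  show "disjnt p q"
  proof (rule ccontr)
    assume "\<not> disjnt p q"
    then obtain u where "stack_outer u \<in> C" "stack_outer u \<in> D"
      using CD by (auto simp: disjnt_def)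
    then have "C = D" using component_eq_class CD(1,2) by metis
    with CD ne show False by simp
  qed
next
  show "{} \<notin> compose \<rho>1 \<rho>2"
  proof
    assume "{} \<in> compose \<rho>1 \<rho>2"
    then obtain C where "C \<in> components \<rho>1 \<rho>2 - middle_components \<rho>1 \<rho>2" "stack_outer -` C = {}"
      unfolding compose_def by (metis (no_types, lifting) imageE)
    then show False using nonmiddle_iff_outer by (simp add: middle_components_def)
  qed
qed

lemma compose_in_half_diagrams:
  assumes "\<rho>1 \<in> half_diagrams k" "\<rho>2 \<in> half_diagrams k"
  shows "compose \<rho>1 \<rho>2 \<in> half_diagrams k"
proof -
  have d: "\<rho>1 \<in> diagrams k" "\<rho>2 \<in> diagrams k"
    using assms by (auto simp: half_diagrams_def)
  obtain B1 B2 where B: "B1 \<in> \<rho>1" "Top k \<in> B1" "Bot k \<in> B1" "B2 \<in> \<rho>2" "Top k \<in> B2" "Bot k \<in> B2"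
    using assms by (auto simp: half_diagrams_def)
  have "stack_first ` B1 \<in> stacked_blocks \<rho>1 \<rho>2" "stack_second ` B2 \<in> stacked_blocks \<rho>1 \<rho>2"
    using B by (auto simp: stacked_blocks_def)
  then have "(stack_first (Top k), stack_first (Bot k)) \<in> linked \<rho>1 \<rho>2"
    "(stack_second (Top k), stack_second (Bot k)) \<in> linked \<rho>1 \<rho>2"
    using B linked_block by (metis imageI)+
  then have tb: "(stack_outer (Top k), stack_outer (Bot k)) \<in> linked \<rho>1 \<rho>2"
    using linked_trans by simp
  have c: "compose \<rho>1 \<rho>2 \<in> diagrams k" using d by (rule compose_in_diagrams)
  have "Top k \<in> \<Union> \<rho>1" using B by blast
  also have "\<Union> \<rho>1 = \<Union> (compose \<rho>1 \<rho>2)" using c d by (simp add: diagrams_def partition_on_def)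
  finally obtain C where C: "C \<in> components \<rho>1 \<rho>2" "stack_outer -` C \<in> compose \<rho>1 \<rho>2" "stack_outer (Top k) \<in> C"
    by (auto simp: compose_def)
  then have "stack_outer (Bot k) \<in> C"
    using tb component_eq_class[OF C(1) C(3)] by blast
  then have "Top k \<in> stack_outer -` C \<and> Bot k \<in> stack_outer -` C"
    using C(3) by simp
  with c C(2) show ?thesis unfolding half_diagrams_def by blast
qed

lemma monochromatic_stacked_blocks:
  "monochromatic (stacked_label a c b) (stacked_blocks \<rho>1 \<rho>2)
    \<longleftrightarrow> monochromatic (label a c) \<rho>1 \<and> monochromatic (label c b) \<rho>2"
proof -
  have "stacked_label a c b (stack_first u) = label a c u"
    "stacked_label a c b (stack_second u) = label c b u" for u by (cases u; simp)+
  then show ?thesis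
    unfolding monochromatic_def stacked_blocks_def by (simp add: ball_Un)
qed

lemma monochromatic_components:
  "monochromatic f (stacked_blocks \<rho>1 \<rho>2) \<longleftrightarrow> monochromatic f (components \<rho>1 \<rho>2)"
proof
  assume f: "monochromatic f (stacked_blocks \<rho>1 \<rho>2)"
  have "f x = f y" if "(x, y) \<in> linked \<rho>1 \<rho>2" for x y
    using that unfolding linked_def
    by (induction rule: rtrancl_induct) (use f in \<open>auto simp: monochromatic_def\<close>)
  then show "monochromatic f (components \<rho>1 \<rho>2)"
    unfolding monochromatic_def by (metis Image_singleton_iff component_eq_class)
next
  assume f: "monochromatic f (components \<rho>1 \<rho>2)"
  show "monochromatic f (stacked_blocks \<rho>1 \<rho>2)"
    unfolding monochromatic_def
  proof (intro ballI)
    fix B u v assume B: "B \<in> stacked_blocks \<rho>1 \<rho>2" "u \<in> B" "v \<in> B"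
    then have "linked \<rho>1 \<rho>2 `` {u} \<in> components \<rho>1 \<rho>2"
      unfolding components_eq_quotient by (blast intro: quotientI)
    moreover have "v \<in> linked \<rho>1 \<rho>2 `` {u}" "u \<in> linked \<rho>1 \<rho>2 `` {u}"
      using B by (auto intro: linked_block linked_refl)
    ultimately show "f u = f v" using f unfolding monochromatic_def by blast
  qed
qed

lemma stacked_label_outer: "stacked_label a c b (stack_outer u) = label a b u"
  by (cases u) simp_all

lemma monochromatic_compose:
  assumes "monochromatic (stacked_label a c b) (components \<rho>1 \<rho>2)"
  shows "monochromatic (label a b) (compose \<rho>1 \<rho>2)"
  using assms unfolding monochromatic_def compose_def
  by (auto simp flip: stacked_label_outer[of a c b])

text \<open>Given labels on the two outer rows, the label of a middle vertex is forced when its component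
  meets an outer row, and the remaining components, those of \<open>middle_components\<close>, can be labelled
  freely. This is where the factor $z^\ell$ of the multiplication comes from.\<close>

lemma card_middle_labellings:
  assumes d: "\<rho>1 \<in> diagrams k" "\<rho>2 \<in> diagrams k"
    and a: "a \<in> labellings n k" and b: "b \<in> labellings n k"
    and m: "monochromatic (label a b) (compose \<rho>1 \<rho>2)"
  shows "card {c \<in> labellings n k. monochromatic (stacked_label a c b) (components \<rho>1 \<rho>2)}
    = n ^ card (middle_components \<rho>1 \<rho>2)"
proof -
  let ?M = "middle_components \<rho>1 \<rho>2"
  let ?A = "{c \<in> labellings n k. monochromatic (stacked_label a c b) (components \<rho>1 \<rho>2)}"
  define cl where "cl x = linked \<rho>1 \<rho>2 `` {x}" for x
  \<comment> \<open>The label of a component: prescribed by \<open>g\<close> if free, and read off from an outer vertex otherwise.\<close>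
  define colour where
    "colour g C = (if C \<in> ?M then g C else label a b (SOME u. stack_outer u \<in> C))" for g C
  define extend where
    "extend g = restrict (\<lambda>r. colour g (cl (Middle r))) {1..k}" for g
  define res where
    "res c = restrict (\<lambda>C. stacked_label a c b (SOME x. x \<in> C)) ?M" for c
  have cl: "cl x \<in> components \<rho>1 \<rho>2" if "x \<in> stacked_vertices k" for x
    using that class_in_components[OF d] by (simp add: cl_def)
  have mem_cl: "x \<in> cl x" for x by (simp add: cl_def linked_refl)
  have outer_not_middle: "cl (stack_outer u) \<notin> ?M" for u
    using mem_cl[of "stack_outer u"] nonmiddle_iff_outer[of "cl (stack_outer u)"]
    by (auto simp: middle_components_def)
  have colour_outer: "colour g C = label a b u"
    if "C \<in> components \<rho>1 \<rho>2" "stack_outer u \<in> C" for g C u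
  proof -
    have C: "C = cl (stack_outer u)" using component_eq_class[OF that] by (simp add: cl_def)
    have "stack_outer (SOME u. stack_outer u \<in> C) \<in> C" using that(2) by (rule someI)
    then have "label a b (SOME u. stack_outer u \<in> C) = label a b u"
      using m that C outer_not_middle[of u]
      unfolding monochromatic_def compose_def by (metis (no_types, lifting) DiffI imageI vimageI2)
    then show ?thesis using C outer_not_middle[of u] by (simp add: colour_def)
  qed
  have ext_label: "stacked_label a (extend g) b x = colour g (cl x)" if "x \<in> stacked_vertices k" for g x
  proof (cases "\<exists>u. x = stack_outer u")
    case True
    then obtain u where "x = stack_outer u" by blast
    then show ?thesis using colour_outer[OF cl[OF that], of u] mem_cl[of x]
      by (simp add: stacked_label_outer)
  next
    case False
    then have "x \<noteq> Upper r \<and> x \<noteq> Lower r" for r by (metis stack_outer.simps)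
    then show ?thesis using that by (auto simp: stacked_vertices_def extend_def)
  qed
  have val: "stacked_label a c b x < n" if "x \<in> stacked_vertices k" "c \<in> labellings n k" for c x
    using that a b by (auto simp: stacked_vertices_def labellings_def)
  have "bij_betw res ?A (?M \<rightarrow>\<^sub>E {..<n})"
  proof (rule bij_betw_byWitness[where f' = extend])
    show "\<forall>c\<in>?A. extend (res c) = c"
    proof
      fix c assume c: "c \<in> ?A"
      show "extend (res c) = c"
      proof
        fix r
        show "extend (res c) r = c r"
        proof (cases "r \<in> {1..k}")
          case False
          then show ?thesis using c by (auto simp: extend_def labellings_def PiE_def extensional_def)
        next
          case True
          then have r: "Middle r \<in> stacked_vertices k" by (simp add: stacked_vertices_def)
          have const: "stacked_label a c b x = stacked_label a c b (Middle r)" if "x \<in> cl (Middle r)" for x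
            using c cl[OF r] that mem_cl[of "Middle r"] unfolding monochromatic_def by blast
          show ?thesis
          proof (cases "cl (Middle r) \<in> ?M")
            case M: True
            have "(SOME x. x \<in> cl (Middle r)) \<in> cl (Middle r)" using mem_cl by (rule someI)
            then show ?thesis using const True M by (simp add: extend_def colour_def res_def)
          next
            case False
            then obtain u where u: "stack_outer u \<in> cl (Middle r)"
              using cl[OF r] nonmiddle_iff_outer by (force simp: middle_components_def)
            then show ?thesis using const[OF u] colour_outer[OF cl[OF r] u] True
              by (simp add: extend_def stacked_label_outer)
          qed
        qed
      qed
    qed
    show "\<forall>g\<in>?M \<rightarrow>\<^sub>E {..<n}. res (extend g) = g"
    proof
      fix g assume g: "g \<in> ?M \<rightarrow>\<^sub>E {..<n}"
      show "res (extend g) = g"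
      proof
        fix C
        show "res (extend g) C = g C"
        proof (cases "C \<in> ?M")
          case False
          then show ?thesis using g by (auto simp: res_def PiE_def extensional_def)
        next
          case True
          then have C: "C \<in> components \<rho>1 \<rho>2" by (simp add: middle_components_def)
          then have x: "(SOME x. x \<in> C) \<in> C" (is "?x \<in> _") using component_nonempty some_in_eq by blast
          then have "cl ?x = C" "?x \<in> stacked_vertices k"
            using component_eq_class[OF C] component_subset[OF d C] by (auto simp: cl_def)
          then show ?thesis using True ext_label[of ?x] by (simp add: res_def colour_def)
        qed
      qed
    qed
    show "res ` ?A \<subseteq> ?M \<rightarrow>\<^sub>E {..<n}"
    proof (intro image_subsetI PiE_I)
      fix c C assume c: "c \<in> ?A" and "C \<in> ?M"
      then have C: "C \<in> components \<rho>1 \<rho>2" by (simp add: middle_components_def)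
      then have "(SOME x. x \<in> C) \<in> C" using component_nonempty some_in_eq by blast
      then show "res c C \<in> {..<n}"
        using component_subset[OF d C] val c \<open>C \<in> ?M\<close> by (auto simp: res_def)
    qed (simp add: res_def)
    show "extend ` (?M \<rightarrow>\<^sub>E {..<n}) \<subseteq> ?A"
    proof (intro image_subsetI CollectI conjI)
      fix g assume g: "g \<in> ?M \<rightarrow>\<^sub>E {..<n}"
      show "extend g \<in> labellings n k"
        unfolding labellings_def
      proof (rule PiE_I)
        fix r assume r: "r \<in> {1..k}"
        then have rv: "Middle r \<in> stacked_vertices k" by (simp add: stacked_vertices_def)
        show "extend g r \<in> {..<n}"
        proof (cases "cl (Middle r) \<in> ?M")
          case True
          then show ?thesis using g r by (auto simp: extend_def colour_def)
        next
          case False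
          then obtain u where u: "stack_outer u \<in> cl (Middle r)"
            using cl[OF rv] nonmiddle_iff_outer by (force simp: middle_components_def)
          then have "stack_outer u \<in> stacked_vertices k" using component_subset[OF d cl[OF rv]] by blast
          then have "label a b u < n" using val[OF _ a] stacked_label_outer by metis
          then show ?thesis using colour_outer[OF cl[OF rv] u] r by (simp add: extend_def)
        qed
      qed (auto simp: extend_def)
      show "monochromatic (stacked_label a (extend g) b) (components \<rho>1 \<rho>2)"
        unfolding monochromatic_def
      proof (intro ballI)
        fix C x y assume C: "C \<in> components \<rho>1 \<rho>2" and "x \<in> C" "y \<in> C"
        then have "cl x = C" "cl y = C" "x \<in> stacked_vertices k" "y \<in> stacked_vertices k"
          using component_eq_class[OF C] component_subset[OF d C] by (auto simp: cl_def)
        then show "stacked_label a (extend g) b x = stacked_label a (extend g) b y"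
          by (simp add: ext_label)
      qed
    qed
  qed
  then have "card ?A = card (?M \<rightarrow>\<^sub>E {..<n})" by (rule bij_betw_same_card)
  also have "finite ?M" using finite_components[OF d] by (simp add: middle_components_def)
  then have "card (?M \<rightarrow>\<^sub>E {..<n}) = n ^ card ?M" by (simp add: card_PiE)
  finally show ?thesis .
qed

section \<open>The representation on functions of labellings\<close>

text \<open>The row vector $f$ is multiplied from the right by the 0-1 matrix of the diagram. Hence in a product
  of elements the left factor is applied to \<open>f\<close> first; evaluated at a labelling \<open>b\<close>, however, the
  factors transform \<open>b\<close> from right to left.\<close>

definition diagram_act :: "nat \<Rightarrow> nat \<Rightarrow> diagram \<Rightarrow> ((nat \<Rightarrow> nat) \<Rightarrow> int) \<Rightarrow> (nat \<Rightarrow> nat) \<Rightarrow> int" where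
  "diagram_act n k \<rho> f b = (\<Sum>a | a \<in> labellings n k \<and> monochromatic (label a b) \<rho>. f a)"

definition act :: "nat \<Rightarrow> nat \<Rightarrow> element \<Rightarrow> ((nat \<Rightarrow> nat) \<Rightarrow> int) \<Rightarrow> (nat \<Rightarrow> nat) \<Rightarrow> int" where
  "act n k x f b =
     (\<Sum>\<rho>\<in>Poly_Mapping.keys x. poly (Poly_Mapping.lookup x \<rho>) (int n) * diagram_act n k \<rho> f b)"

text \<open>Both sides sum \<open>f a\<close> over labellings \<open>c\<close> of the middle row that make all components of the
  stacked graph monochromatic, so the claim is a count of these \<open>c\<close>.\<close>

lemma diagram_act_compose:
  assumes d: "\<rho>1 \<in> diagrams k" "\<rho>2 \<in> diagrams k" and b: "b \<in> labellings n k"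
  shows "diagram_act n k \<rho>2 (diagram_act n k \<rho>1 f) b
    = int n ^ card (middle_components \<rho>1 \<rho>2) * diagram_act n k (compose \<rho>1 \<rho>2) f b"
proof -
  let ?W = "labellings n k"
  let ?ok = "\<lambda>a c. monochromatic (stacked_label a c b) (components \<rho>1 \<rho>2)"
  have "diagram_act n k \<rho>2 (diagram_act n k \<rho>1 f) b
    = (\<Sum>c\<in>?W. if monochromatic (label c b) \<rho>2 then
        (\<Sum>a\<in>?W. if monochromatic (label a c) \<rho>1 then f a else 0) else 0)"
    by (simp add: diagram_act_def sum.If_cases Int_def)
  also have "\<dots> = (\<Sum>c\<in>?W. \<Sum>a\<in>?W. if ?ok a c then f a else 0)"
    by (intro sum.cong)
      (auto simp flip: monochromatic_components simp: monochromatic_stacked_blocks intro!: sum.cong)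
  also have "\<dots> = (\<Sum>a\<in>?W. \<Sum>c\<in>?W. if ?ok a c then f a else 0)"
    by (rule sum.swap)
  also have "\<dots> = (\<Sum>a\<in>?W. f a * int (card {c \<in> ?W. ?ok a c}))"
    by (simp add: sum.If_cases Int_def mult.commute)
  also have "\<dots> = (\<Sum>a\<in>?W. if monochromatic (label a b) (compose \<rho>1 \<rho>2)
      then f a * int n ^ card (middle_components \<rho>1 \<rho>2) else 0)"
  proof (rule sum.cong[OF refl])
    fix a assume a: "a \<in> ?W"
    show "f a * int (card {c \<in> ?W. ?ok a c}) = (if monochromatic (label a b) (compose \<rho>1 \<rho>2)
      then f a * int n ^ card (middle_components \<rho>1 \<rho>2) else 0)"
    proof (cases "monochromatic (label a b) (compose \<rho>1 \<rho>2)")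
      case True
      then show ?thesis using card_middle_labellings[OF d a b True] by simp
    next
      case False
      then have "{c \<in> ?W. ?ok a c} = {}" using monochromatic_compose by blast
      then show ?thesis using False by (metis card.empty mult_zero_right of_nat_0)
    qed
  qed
  also have "\<dots> = int n ^ card (middle_components \<rho>1 \<rho>2) * diagram_act n k (compose \<rho>1 \<rho>2) f b"
    by (simp add: diagram_act_def sum.If_cases Int_def sum_distrib_left mult.commute)
  finally show ?thesis .
qed

lemma act_superset:
  assumes "finite S" "Poly_Mapping.keys x \<subseteq> S"
  shows "act n k x f b =
    (\<Sum>\<rho>\<in>S. poly (Poly_Mapping.lookup x \<rho>) (int n) * diagram_act n k \<rho> f b)"
  unfolding act_def using assms by (intro sum.mono_neutral_left) (auto simp: in_keys_iff)

lemma act_0 [simp]: "act n k 0 f b = 0"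
  by (simp add: act_def)

lemma act_add [simp]: "act n k (x + y) f b = act n k x f b + act n k y f b"
proof -
  let ?S = "Poly_Mapping.keys x \<union> Poly_Mapping.keys y"
  have "Poly_Mapping.keys (x + y) \<subseteq> ?S" by (rule keys_add)
  then show ?thesis
    by (simp add: act_superset[of ?S] lookup_add sum.distrib distrib_right)
qed

lemma act_uminus [simp]: "act n k (- x) f b = - act n k x f b"
  by (simp add: act_def sum_negf)

lemma act_diff [simp]: "act n k (x - y) f b = act n k x f b - act n k y f b"
  by (simp only: diff_conv_add_uminus[of x] act_add act_uminus)

lemma lookup_scale [simp]: "Poly_Mapping.lookup (scale r x) \<rho> = r * Poly_Mapping.lookup x \<rho>"
  by (simp add: scale_def Poly_Mapping.map.rep_eq when_def)

lemma keys_scale: "Poly_Mapping.keys (scale r x) \<subseteq> Poly_Mapping.keys x"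
  by (auto simp: in_keys_iff)

lemma act_scale [simp]: "act n k (scale r x) f b = poly r (int n) * act n k x f b"
  by (subst act_superset[OF finite_keys keys_scale]) (simp add: act_def sum_distrib_left mult.assoc)

lemma act_basis [simp]: "act n k (basis \<rho>) f b = diagram_act n k \<rho> f b"
  by (simp add: act_def basis_def)

lemma act_sum: "act n k (sum g A) f b = (\<Sum>i\<in>A. act n k (g i) f b)"
  by (induction A rule: infinite_finite_induct) auto

lemma diagram_act_sum:
  "diagram_act n k \<rho> (\<lambda>a. \<Sum>i\<in>A. g i a) b = (\<Sum>i\<in>A. diagram_act n k \<rho> (g i) b)"
  unfolding diagram_act_def by (rule sum.swap)

lemma diagram_act_scale:
  "diagram_act n k \<rho> (\<lambda>a. r * f a) b = r * diagram_act n k \<rho> f b"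
  unfolding diagram_act_def by (rule sum_distrib_left[symmetric])

lemma act_mult [simp]:
  assumes "x \<in> partition_algebra k" "y \<in> partition_algebra k" "b \<in> labellings n k"
  shows "act n k (x \<cdot> y) f b = act n k y (act n k x f) b"
proof -
  have "act n k (x \<cdot> y) f b
    = (\<Sum>\<rho>1\<in>Poly_Mapping.keys x. \<Sum>\<rho>2\<in>Poly_Mapping.keys y.
        poly (Poly_Mapping.lookup x \<rho>1) (int n) * poly (Poly_Mapping.lookup y \<rho>2) (int n) *
        diagram_act n k \<rho>2 (diagram_act n k \<rho>1 f) b)"
    unfolding mult_def act_sum
  proof (intro sum.cong refl)
    fix \<rho>1 \<rho>2 assume "\<rho>1 \<in> Poly_Mapping.keys x" "\<rho>2 \<in> Poly_Mapping.keys y"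
    then have "\<rho>1 \<in> diagrams k" "\<rho>2 \<in> diagrams k"
      using assms by (auto simp: partition_algebra_def)
    then show "act n k (scale (Poly_Mapping.lookup x \<rho>1 * Poly_Mapping.lookup y \<rho>2 *
          z ^ card (middle_components \<rho>1 \<rho>2)) (basis (compose \<rho>1 \<rho>2))) f b
      = poly (Poly_Mapping.lookup x \<rho>1) (int n) * poly (Poly_Mapping.lookup y \<rho>2) (int n) *
        diagram_act n k \<rho>2 (diagram_act n k \<rho>1 f) b"
      using diagram_act_compose[OF _ _ assms(3)] by (simp add: z_def poly_monom)
  qed
  also have "\<dots> = (\<Sum>\<rho>2\<in>Poly_Mapping.keys y. \<Sum>\<rho>1\<in>Poly_Mapping.keys x.
        poly (Poly_Mapping.lookup x \<rho>1) (int n) * poly (Poly_Mapping.lookup y \<rho>2) (int n) *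
        diagram_act n k \<rho>2 (diagram_act n k \<rho>1 f) b)"
    by (rule sum.swap)
  also have "\<dots> = act n k y (act n k x f) b"
    by (simp add: act_def[abs_def] diagram_act_sum diagram_act_scale sum_distrib_left)
      (simp add: mult_ac)
  finally show ?thesis .
qed

lemma partition_algebra_0 [simp]: "0 \<in> partition_algebra k"
  by (simp add: partition_algebra_def)

lemma partition_algebra_add [simp]:
  "x \<in> partition_algebra k \<Longrightarrow> y \<in> partition_algebra k \<Longrightarrow> x + y \<in> partition_algebra k"
  using keys_add[of x y] by (auto simp: partition_algebra_def)

lemma partition_algebra_uminus [simp]: "x \<in> partition_algebra k \<Longrightarrow> - x \<in> partition_algebra k"
  by (simp add: partition_algebra_def)

lemma partition_algebra_diff [simp]:
  "x \<in> partition_algebra k \<Longrightarrow> y \<in> partition_algebra k \<Longrightarrow> x - y \<in> partition_algebra k"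
  by (simp only: diff_conv_add_uminus[of x] partition_algebra_add partition_algebra_uminus)

lemma partition_algebra_basis: "\<rho> \<in> diagrams k \<Longrightarrow> basis \<rho> \<in> partition_algebra k"
  by (simp add: partition_algebra_def basis_def)

lemma keys_mult:
  "Poly_Mapping.keys (x \<cdot> y) \<subseteq> (\<lambda>(\<rho>1, \<rho>2). compose \<rho>1 \<rho>2) ` (Poly_Mapping.keys x \<times> Poly_Mapping.keys y)"
proof
  fix \<rho> assume "\<rho> \<in> Poly_Mapping.keys (x \<cdot> y)"
  then have "Poly_Mapping.lookup (x \<cdot> y) \<rho> \<noteq> 0" by (simp add: in_keys_iff)
  then obtain \<rho>1 where 1: "\<rho>1 \<in> Poly_Mapping.keys x" and "(\<Sum>\<rho>2\<in>Poly_Mapping.keys y. Poly_Mapping.lookup (scale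
      (Poly_Mapping.lookup x \<rho>1 * Poly_Mapping.lookup y \<rho>2 * z ^ card (middle_components \<rho>1 \<rho>2))
      (basis (compose \<rho>1 \<rho>2))) \<rho>) \<noteq> 0"
    unfolding mult_def lookup_sum by (meson sum.not_neutral_contains_not_neutral)
  then obtain \<rho>2 where 2: "\<rho>2 \<in> Poly_Mapping.keys y" and "Poly_Mapping.lookup (scale
      (Poly_Mapping.lookup x \<rho>1 * Poly_Mapping.lookup y \<rho>2 * z ^ card (middle_components \<rho>1 \<rho>2))
      (basis (compose \<rho>1 \<rho>2))) \<rho> \<noteq> 0"
    by (meson sum.not_neutral_contains_not_neutral)
  then have "\<rho> = compose \<rho>1 \<rho>2"
    by (auto simp: basis_def lookup_single when_def split: if_splits)
  with 1 2 show "\<rho> \<in> (\<lambda>(\<rho>1, \<rho>2). compose \<rho>1 \<rho>2) ` (Poly_Mapping.keys x \<times> Poly_Mapping.keys y)"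
    by auto
qed

lemma partition_algebra_mult [simp]:
  "x \<in> partition_algebra k \<Longrightarrow> y \<in> partition_algebra k \<Longrightarrow> x \<cdot> y \<in> partition_algebra k"
  using keys_mult[of x y] by (fastforce simp: partition_algebra_def intro: compose_in_diagrams)

text \<open>The diagrams in which \<open>k\<close> and \<open>k'\<close> share a block are closed under composition, so every element of
  the subalgebra that they generate is already a linear combination of them.\<close>

lemma keys_half_partition_algebra:
  assumes "x \<in> half_partition_algebra k"
  shows "Poly_Mapping.keys x \<subseteq> half_diagrams k"
  using assms
proof induction
  case (generator \<rho>)
  then show ?case by (simp add: basis_def)
next
  case (add x y)
  then show ?case using keys_add[of x y] by blast
next
  case (scale x r)
  then show ?case using keys_scale[of r x] by blast
next
  case (mult x y)
  then show ?case using keys_mult[of x y] by (fastforce intro: compose_in_half_diagrams)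
qed


section \<open>Faithfulness for all parameters together\<close>

definition kernel :: "'a set set \<Rightarrow> ('a \<times> 'a) set" where
  "kernel P = {(u, v). \<exists>B\<in>P. u \<in> B \<and> v \<in> B}"

lemma kernel_inj:
  assumes "partition_on A P" "partition_on A Q" "kernel P = kernel Q"
  shows "P = Q"
proof -
  have "A // kernel P = P" "A // kernel Q = Q"
    using partition_on_eq_quotient assms(1,2) unfolding kernel_def by blast+
  then show ?thesis using assms(3) by metis
qed

text \<open>Labelling each block of \<open>\<rho>\<close> by a colour of its own makes exactly the refinements of \<open>\<rho>\<close>
  monochromatic. It needs as many labels as there are blocks, which is why no single \<open>n\<close> serves for
  all \<open>k\<close>.\<close>

lemma ex_labelling_with_kernel:
  assumes "\<rho> \<in> diagrams k" and n: "card \<rho> \<le> n"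
  obtains a b where "a \<in> labellings n k" "b \<in> labellings n k"
    "\<And>\<rho>'. \<rho>' \<in> diagrams k \<Longrightarrow> monochromatic (label a b) \<rho>' \<longleftrightarrow> kernel \<rho>' \<subseteq> kernel \<rho>"
proof -
  have P: "partition_on (vertices k) \<rho>" using assms by (simp add: diagrams_def)
  have "finite (vertices k)" by (simp add: vertices_def)
  then have "finite \<rho>" using P by (rule finite_elements)
  then obtain h where h: "bij_betw h \<rho> {..<card \<rho>}"
    by (metis ex_bij_betw_finite_nat atLeast0LessThan)
  define blk where "blk u = (THE B. B \<in> \<rho> \<and> u \<in> B)" for u
  have ex1: "\<exists>!B. B \<in> \<rho> \<and> u \<in> B" if "u \<in> vertices k" for u
    using P that unfolding partition_on_def disjoint_def by blast
  have blk: "blk u \<in> \<rho> \<and> u \<in> blk u" if "u \<in> vertices k" for u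
    unfolding blk_def using ex1[OF that] by (rule theI')
  have blk_eq: "blk u = B" if "B \<in> \<rho>" "u \<in> B" for u B
  proof -
    have "u \<in> vertices k" using that P by (auto simp: partition_on_def)
    then show ?thesis using ex1[of u] blk[of u] that by blast
  qed
  define a where "a = restrict (\<lambda>r. h (blk (Top r))) {1..k}"
  define b where "b = restrict (\<lambda>r. h (blk (Bot r))) {1..k}"
  have lab: "label a b u = h (blk u)" if "u \<in> vertices k" for u
    using that by (auto simp: vertices_def a_def b_def)
  have hlt: "h (blk u) < n" if "u \<in> vertices k" for u
  proof -
    have "h (blk u) \<in> {..<card \<rho>}" using blk[OF that] h bij_betwE by blast
    then show ?thesis using n by simp
  qed
  have "a \<in> labellings n k" "b \<in> labellings n k"
    using hlt unfolding labellings_def a_def b_def by (auto simp: vertices_def)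
  moreover have "monochromatic (label a b) \<rho>' \<longleftrightarrow> kernel \<rho>' \<subseteq> kernel \<rho>"
    if "\<rho>' \<in> diagrams k" for \<rho>'
  proof -
    have same: "label a b u = label a b v \<longleftrightarrow> (u, v) \<in> kernel \<rho>"
      if "u \<in> vertices k" "v \<in> vertices k" for u v
    proof -
      have "label a b u = label a b v \<longleftrightarrow> blk u = blk v"
        using lab that blk inj_on_eq_iff[OF bij_betw_imp_inj_on[OF h]] by simp
      also have "\<dots> \<longleftrightarrow> (u, v) \<in> kernel \<rho>"
      proof
        assume "blk u = blk v"
        then show "(u, v) \<in> kernel \<rho>" using blk that unfolding kernel_def by blast
      next
        assume "(u, v) \<in> kernel \<rho>"
        then show "blk u = blk v" using blk_eq by (auto simp: kernel_def)
      qed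
      finally show ?thesis .
    qed
    have "u \<in> vertices k" if "B \<in> \<rho>'" "u \<in> B" for u B
      using that \<open>\<rho>' \<in> diagrams k\<close> by (auto simp: diagrams_def partition_on_def)
    then have "monochromatic (label a b) \<rho>' \<longleftrightarrow> (\<forall>B\<in>\<rho>'. \<forall>u\<in>B. \<forall>v\<in>B. (u, v) \<in> kernel \<rho>)"
      unfolding monochromatic_def using same by meson
    also have "\<dots> \<longleftrightarrow> kernel \<rho>' \<subseteq> kernel \<rho>"
      unfolding kernel_def[of \<rho>'] by blast
    finally show ?thesis .
  qed
  ultimately show ?thesis by (rule that)
qed

text \<open>If \<open>\<rho>\<close> is a finest diagram in the support of \<open>x\<close>, then a labelling whose kernel is \<open>\<rho>\<close>
  separates \<open>\<rho>\<close> from the other diagrams of the support. The corresponding matrix entry is the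
  coefficient polynomial of \<open>\<rho>\<close> evaluated at \<open>n\<close>. It vanishes for all large \<open>n\<close>, hence identically.\<close>

lemma eq_0_if_act_0:
  assumes x: "x \<in> partition_algebra k"
    and act: "\<And>n f b. b \<in> labellings n k \<Longrightarrow> act n k x f b = 0"
  shows "x = 0"
proof (rule ccontr)
  assume "x \<noteq> 0"
  then obtain \<rho>0 where "\<rho>0 \<in> Poly_Mapping.keys x" by fastforce
  then obtain \<rho> where \<rho>: "\<rho> \<in> Poly_Mapping.keys x"
    and min: "\<And>\<rho>'. \<rho>' \<in> Poly_Mapping.keys x \<Longrightarrow> card (kernel \<rho>) \<le> card (kernel \<rho>')"
    using ex_has_least_nat[of "\<lambda>\<rho>. \<rho> \<in> Poly_Mapping.keys x" \<rho>0 "\<lambda>\<rho>. card (kernel \<rho>)"] by blast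
  have d: "\<rho>' \<in> diagrams k" if "\<rho>' \<in> Poly_Mapping.keys x" for \<rho>'
    using that x by (auto simp: partition_algebra_def)
  have fin: "finite (kernel \<rho>)"
  proof (rule finite_subset)
    show "kernel \<rho> \<subseteq> vertices k \<times> vertices k"
      using d[OF \<rho>] by (auto simp: kernel_def diagrams_def partition_on_def)
  qed (simp add: vertices_def)
  have "poly (Poly_Mapping.lookup x \<rho>) (int n) = 0" if n: "card \<rho> \<le> n" for n
  proof -
    obtain a b where a: "a \<in> labellings n k" and b: "b \<in> labellings n k"
      and ab: "\<And>\<rho>'. \<rho>' \<in> diagrams k \<Longrightarrow> monochromatic (label a b) \<rho>' \<longleftrightarrow> kernel \<rho>' \<subseteq> kernel \<rho>"
      using ex_labelling_with_kernel[OF d[OF \<rho>] n] by metis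
    have mono: "monochromatic (label a b) \<rho>' \<longleftrightarrow> \<rho>' = \<rho>" if "\<rho>' \<in> Poly_Mapping.keys x" for \<rho>'
    proof
      assume "monochromatic (label a b) \<rho>'"
      then have "kernel \<rho>' \<subseteq> kernel \<rho>" using ab d that by blast
      then have "kernel \<rho>' = kernel \<rho>" using fin min[OF that] by (metis card_seteq)
      then show "\<rho>' = \<rho>" using kernel_inj d[OF that] d[OF \<rho>] unfolding diagrams_def by blast
    qed (use ab d \<rho> in auto)
    \<comment> \<open>The indicator function of \<open>a\<close> picks out the matrix entry at \<open>(a, b)\<close>.\<close>
    let ?f = "\<lambda>c. if c = a then 1 else 0"
    have "diagram_act n k \<rho>' ?f b = (if \<rho>' = \<rho> then 1 else 0)" if "\<rho>' \<in> Poly_Mapping.keys x" for \<rho>'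
      using mono[OF that] a by (simp add: diagram_act_def)
    then have "act n k x ?f b
      = (\<Sum>\<rho>'\<in>Poly_Mapping.keys x. if \<rho>' = \<rho> then poly (Poly_Mapping.lookup x \<rho>') (int n) else 0)"
      unfolding act_def by (intro sum.cong) auto
    also have "\<dots> = poly (Poly_Mapping.lookup x \<rho>) (int n)" using \<rho> by simp
    finally show ?thesis using act[OF b] by simp
  qed
  then have "int ` {card \<rho>..} \<subseteq> {t. poly (Poly_Mapping.lookup x \<rho>) t = 0}" by auto
  moreover have "infinite (int ` {card \<rho>..})"
    by (simp add: finite_image_iff infinite_Ici)
  ultimately have "infinite {t. poly (Poly_Mapping.lookup x \<rho>) t = 0}" using finite_subset by blast
  then have "Poly_Mapping.lookup x \<rho> = 0" using poly_roots_finite by blast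
  then show False using \<rho> by (simp add: in_keys_iff)
qed

lemma commutesI:
  assumes "x \<in> partition_algebra k" "y \<in> partition_algebra k"
    and "\<And>n f b. b \<in> labellings n k \<Longrightarrow> act n k x (act n k y f) b = act n k y (act n k x f) b"
  shows "commutes x y"
proof -
  have "x \<cdot> y - y \<cdot> x = 0"
  proof (rule eq_0_if_act_0[of _ k])
    show "x \<cdot> y - y \<cdot> x \<in> partition_algebra k" using assms(1,2) by simp
    fix n f b assume b: "b \<in> labellings n k"
    show "act n k (x \<cdot> y - y \<cdot> x) f b = 0"
      using assms(3)[OF b, of f] by (simp only: act_diff act_mult[OF assms(1,2) b] act_mult[OF assms(2,1) b])
  qed
  then show ?thesis unfolding commutes_def by (rule iffD2[OF eq_iff_diff_eq_0])
qed

section \<open>The action of the generators\<close>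

lemma partition_on_Un:
  "partition_on A P \<Longrightarrow> partition_on B Q \<Longrightarrow> A \<inter> B = {} \<Longrightarrow> partition_on (A \<union> B) (P \<union> Q)"
  unfolding partition_on_def disjoint_def by (auto 4 3)

definition rows :: "nat set \<Rightarrow> vertex set" where
  "rows S = Top ` S \<union> Bot ` S"

lemma Un_strands_in_diagrams:
  assumes "partition_on (rows S) P" "T \<inter> S = {}" "S \<union> T = {1..k}"
  shows "P \<union> strand ` T \<in> diagrams k"
proof -
  have "partition_on (rows T) (strand ` T)"
    by (rule partition_onI) (auto simp: rows_def strand_def disjnt_def)
  then have "partition_on (rows S \<union> rows T) (P \<union> strand ` T)"
    using assms by (intro partition_on_Un) (auto simp: rows_def)
  moreover have "rows S \<union> rows T = vertices k"
    unfolding vertices_def rows_def assms(3)[symmetric] by auto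
  ultimately show ?thesis by (simp add: diagrams_def)
qed

lemma s_in_partition_algebra [simp]:
  "1 \<le> i \<Longrightarrow> i < k \<Longrightarrow> s k i \<in> partition_algebra k"
  unfolding s_def
  by (intro partition_algebra_basis Un_strands_in_diagrams[where S = "{i, i + 1}"] partition_onI)
    (auto simp: rows_def disjnt_def)

lemma p_in_partition_algebra [simp]:
  "1 \<le> j \<Longrightarrow> j \<le> k \<Longrightarrow> p k j \<in> partition_algebra k"
  unfolding p_def
  by (intro partition_algebra_basis Un_strands_in_diagrams[where S = "{j}"] partition_onI)
    (auto simp: rows_def disjnt_def)

lemma p_half_in_partition_algebra [simp]:
  "1 \<le> i \<Longrightarrow> i < k \<Longrightarrow> p_half k i \<in> partition_algebra k"
  unfolding p_half_def
  by (intro partition_algebra_basis Un_strands_in_diagrams[where S = "{i, i + 1}"] partition_onI)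
    (auto simp: rows_def disjnt_def)

lemma unit_in_partition_algebra [simp]: "unit k \<in> partition_algebra k"
  unfolding unit_def using Un_strands_in_diagrams[of "{}" "{}" "{1..k}" k]
  by (intro partition_algebra_basis) (simp add: rows_def partition_on_empty)

lemma labellings_eqI:
  "a \<in> labellings n k \<Longrightarrow> b \<in> labellings n k \<Longrightarrow> (\<And>r. r \<in> {1..k} \<Longrightarrow> a r = b r) \<Longrightarrow> a = b"
  unfolding labellings_def by (rule PiE_ext)

lemma labellings_less: "b \<in> labellings n k \<Longrightarrow> 1 \<le> r \<Longrightarrow> r \<le> k \<Longrightarrow> b r < n"
  by (auto simp: labellings_def)

text \<open>The guard \<open>r \<ge> 1\<close> in \<open>{1..m}\<close> matters: labellings are \<open>undefined\<close> outside \<open>{1..k}\<close>, and this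
  value may coincide with a label.\<close>

definition permute_upto :: "nat \<Rightarrow> nat \<Rightarrow> nat \<Rightarrow> (nat \<Rightarrow> nat) \<Rightarrow> nat \<Rightarrow> nat" where
  "permute_upto m c d b = (\<lambda>r. if r \<in> {1..m} then transpose c d (b r) else b r)"

lemma permute_upto_in_labellings [simp]:
  "b \<in> labellings n k \<Longrightarrow> c < n \<Longrightarrow> d < n \<Longrightarrow> m \<le> k \<Longrightarrow> permute_upto m c d b \<in> labellings n k"
  unfolding labellings_def permute_upto_def by (auto simp: transpose_def PiE_def Pi_def extensional_def)

lemma swap_in_labellings [simp]:
  "b \<in> labellings n k \<Longrightarrow> 1 \<le> i \<Longrightarrow> i < k \<Longrightarrow> b \<circ> transpose i (Suc i) \<in> labellings n k"
  unfolding labellings_def by (auto simp: transpose_def PiE_def Pi_def extensional_def)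

lemma update_in_labellings [simp]:
  "b \<in> labellings n k \<Longrightarrow> 1 \<le> j \<Longrightarrow> j \<le> k \<Longrightarrow> c < n \<Longrightarrow> b(j := c) \<in> labellings n k"
  unfolding labellings_def by (auto simp: PiE_def Pi_def extensional_def)

lemma monochromatic_empty [simp]: "monochromatic f {}"
  by (simp add: monochromatic_def)

text \<open>Comparing all labels of a block with that of one vertex keeps the simplifier from rewriting with an
  equation and its converse.\<close>

lemma monochromatic_insert [simp]:
  "monochromatic f (insert (insert x B) P) \<longleftrightarrow> (\<forall>v\<in>B. f v = f x) \<and> monochromatic f P"
proof -
  have *: "(\<forall>u\<in>insert x B. \<forall>v\<in>insert x B. f u = f v) \<longleftrightarrow> (\<forall>v\<in>B. f v = f x)"
    unfolding ball_simps(7) by metis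
  show ?thesis unfolding monochromatic_def by (subst ball_simps(7)) (simp only: *)
qed

lemma monochromatic_Un_strands:
  "monochromatic (label a b) (P \<union> strand ` T)
    \<longleftrightarrow> monochromatic (label a b) P \<and> (\<forall>r\<in>T. a r = b r)"
proof -
  have "monochromatic (label a b) (strand ` T) \<longleftrightarrow> (\<forall>r\<in>T. a r = b r)"
    by (simp add: monochromatic_def strand_def) metis
  then show ?thesis unfolding monochromatic_def ball_Un by simp
qed

lemma act_unit [simp]:
  assumes "b \<in> labellings n k"
  shows "act n k (unit k) f b = f b"
proof -
  have "{a \<in> labellings n k. monochromatic (label a b) (strand ` {1..k})} = {b}"
    using assms labellings_eqI[of _ n k b] monochromatic_Un_strands[of _ b "{}"]
    by auto
  then show ?thesis by (simp add: unit_def diagram_act_def)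
qed

lemma act_s [simp]:
  assumes b: "b \<in> labellings n k" and i: "1 \<le> i" "i < k"
  shows "act n k (s k i) f b = f (b \<circ> transpose i (Suc i))"
proof -
  let ?b = "b \<circ> transpose i (Suc i)"
  let ?P = "{{Top i, Bot (i + 1)}, {Top (i + 1), Bot i}}"
  have "{a \<in> labellings n k. monochromatic (label a b) (?P \<union> strand ` ({1..k} - {i, i + 1}))} = {?b}"
    (is "?A = _")
  proof
    show "?A \<subseteq> {?b}"
    proof
      fix a assume "a \<in> ?A"
      then have a: "a \<in> labellings n k" "a i = b (Suc i)" "a (Suc i) = b i"
        "\<And>r. r \<in> {1..k} - {i, Suc i} \<Longrightarrow> a r = b r"
        unfolding mem_Collect_eq monochromatic_Un_strands by auto
      have "a = ?b"
        by (rule labellings_eqI[of _ n k]) (use a b i in \<open>auto simp: transpose_def\<close>)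
      then show "a \<in> {?b}" by simp
    qed
    show "{?b} \<subseteq> ?A"
      unfolding monochromatic_Un_strands using b i
      by (auto simp: transpose_def)
  qed
  then show ?thesis by (simp add: s_def diagram_act_def)
qed

lemma act_p [simp]:
  assumes b: "b \<in> labellings n k" and j: "1 \<le> j" "j \<le> k"
  shows "act n k (p k j) f b = (\<Sum>c<n. f (b(j := c)))"
proof -
  let ?A = "{a \<in> labellings n k.
    monochromatic (label a b) ({{Top j}, {Bot j}} \<union> strand ` ({1..k} - {j}))}"
  have "bij_betw (\<lambda>c. b(j := c)) {..<n} ?A"
  proof (rule bij_betwI[where g = "\<lambda>a. a j"])
    show "(\<lambda>c. b(j := c)) \<in> {..<n} \<rightarrow> ?A"
      unfolding monochromatic_Un_strands using b j by auto
    show "(\<lambda>a. a j) \<in> ?A \<rightarrow> {..<n}"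
      using j by (auto simp: labellings_less)
    fix a assume "a \<in> ?A"
    then have "a \<in> labellings n k" "\<And>r. r \<in> {1..k} - {j} \<Longrightarrow> a r = b r"
      unfolding mem_Collect_eq monochromatic_Un_strands by auto
    then show "b(j := a j) = a"
      using b j by (intro labellings_eqI[of _ n k]) (auto simp: labellings_less)
  qed simp
  then show ?thesis
    by (simp add: p_def diagram_act_def sum.reindex_bij_betw)
qed

lemma act_p_half [simp]:
  assumes b: "b \<in> labellings n k" and i: "1 \<le> i" "i < k"
  shows "act n k (p_half k i) f b = (if b i = b (Suc i) then f b else 0)"
proof -
  let ?P = "{{Top i, Top (i + 1), Bot i, Bot (i + 1)}}"
  have *: "monochromatic (label a b) (?P \<union> strand ` ({1..k} - {i, i + 1}))
      \<longleftrightarrow> b i = b (Suc i) \<and> a = b" if a: "a \<in> labellings n k" for a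
  proof
    assume "monochromatic (label a b) (?P \<union> strand ` ({1..k} - {i, i + 1}))"
    then have "b i = b (Suc i)" "a i = b i" "a (Suc i) = b (Suc i)"
      and "\<And>r. r \<in> {1..k} - {i, Suc i} \<Longrightarrow> a r = b r"
      unfolding monochromatic_Un_strands by auto
    then show "b i = b (Suc i) \<and> a = b"
      using labellings_eqI[OF a b] by (metis Diff_iff insertE singletonD)
  next
    assume "b i = b (Suc i) \<and> a = b"
    then show "monochromatic (label a b) (?P \<union> strand ` ({1..k} - {i, i + 1}))"
      unfolding monochromatic_Un_strands by auto
  qed
  let ?A = "{a \<in> labellings n k. monochromatic (label a b) (?P \<union> strand ` ({1..k} - {i, i + 1}))}"
  have "?A = {a \<in> labellings n k. b i = b (Suc i) \<and> a = b}"
    by (intro Collect_cong conj_cong refl *)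
  also have "\<dots> = (if b i = b (Suc i) then {b} else {})"
    using b by (cases "b i = b (Suc i)") (simp_all, blast)
  finally show ?thesis by (simp add: p_half_def diagram_act_def)
qed

section \<open>The recursions in the representation\<close>

lemma permute_upto_below [simp]: "1 \<le> r \<Longrightarrow> r \<le> m \<Longrightarrow> permute_upto m c d b r = transpose c d (b r)"
  by (simp add: permute_upto_def)

lemma permute_upto_above [simp]: "m < r \<Longrightarrow> permute_upto m c d b r = b r"
  by (simp add: permute_upto_def)

lemma permute_upto_same [simp]: "permute_upto m c c b = b"
  by (auto simp: permute_upto_def)

text \<open>Write $x = b_i$ and $y = b_{i+1}$. If $x \ne y$, then the first and third correction terms vanish.
  The sum coming from $s_i L_i s_i$ agrees with the required one except at $c = x$, where the second
  term removes the wrong summand and $\sigma_{i+1}$ supplies the right one. If $x = y$, then the third term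
  is the required sum and the other four cancel in pairs.\<close>

lemma L_step:
  assumes i: "1 \<le> i" "i < k"
    and L: "L k i \<in> partition_algebra k"
      "\<And>n f b. b \<in> labellings n k \<Longrightarrow> act n k (L k i) f b = (\<Sum>c<n. f (permute_upto i c (b i) b))"
    and \<sigma>: "\<sigma> k (Suc i) \<in> partition_algebra k"
      "\<And>n f b. b \<in> labellings n k \<Longrightarrow>
        act n k (\<sigma> k (Suc i)) f b = f (permute_upto (Suc i) (b i) (b (Suc i)) b)"
    and b: "b \<in> labellings n k"
  shows "act n k (L k (Suc i)) f b = (\<Sum>c<n. f (permute_upto (Suc i) c (b (Suc i)) b))"
proof -
  let ?t = "transpose i (Suc i)"
  define x y where "x = b i" and "y = b (Suc i)"
  have xy: "x < n" "y < n" using i b by (auto simp: x_def y_def intro: labellings_less)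
  have "Suc 0 \<le> i" "i \<le> k" "Suc i \<le> k" using i by simp_all
  note [simp] = this i L \<sigma> b xy x_def[symmetric] y_def[symmetric]
  have T1: "act n k (s k i \<cdot> L k i \<cdot> p_half k i) f b
      = (if x = y then \<Sum>c<n. f (permute_upto i c x b \<circ> ?t) else 0)"
    by (simp cong: sum.cong_simp)
  have T2: "act n k (p_half k i \<cdot> L k i \<cdot> s k i) f b = f (permute_upto i x y (b \<circ> ?t))"
    by (simp cong: sum.cong_simp)
  have T3: "act n k (p_half k i \<cdot> L k i \<cdot> p k (i + 1) \<cdot> p_half k i) f b
      = (if x = y then \<Sum>c<n. f (permute_upto i c x (b(Suc i := c))) else 0)"
    by (simp cong: sum.cong_simp)
  have T4: "act n k (s k i \<cdot> L k i \<cdot> s k i) f b = (\<Sum>c<n. f (permute_upto i c y (b \<circ> ?t) \<circ> ?t))"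
    by (simp cong: sum.cong_simp)
  have rec: "act n k (L k (Suc i)) f b =
      - act n k (s k i \<cdot> L k i \<cdot> p_half k i) f b
      - act n k (p_half k i \<cdot> L k i \<cdot> s k i) f b
      + act n k (p_half k i \<cdot> L k i \<cdot> p k (i + 1) \<cdot> p_half k i) f b
      + act n k (s k i \<cdot> L k i \<cdot> s k i) f b
      + f (permute_upto (Suc i) x y b)"
    unfolding L_rec[OF i(1), unfolded Suc_eq_plus1[symmetric]] by (simp only: act_add act_diff act_uminus) (simp del: act_mult)
  show ?thesis
  proof (cases "x = y")
    case True
    then have "b \<circ> ?t = b" by (auto simp: transpose_def)
    moreover have "permute_upto i c x (b \<circ> ?t) \<circ> ?t = permute_upto i c x b \<circ> ?t" for c
      using True by (auto simp: permute_upto_def transpose_def fun_eq_iff)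
    moreover have "permute_upto i c x (b(Suc i := c)) = permute_upto (Suc i) c x b" for c
      using True by (auto simp: permute_upto_def transpose_def fun_eq_iff)
    ultimately show ?thesis
      unfolding rec T1 T2 T3 T4 using True by simp
  next
    case False
    have eq: "permute_upto i c y (b \<circ> ?t) \<circ> ?t = permute_upto (Suc i) c y b" if "c \<noteq> x" for c
      using that False by (auto simp: permute_upto_def transpose_def fun_eq_iff)
    have eqx: "permute_upto i x y (b \<circ> ?t) \<circ> ?t = permute_upto i x y (b \<circ> ?t)"
      by (auto simp: permute_upto_def transpose_def fun_eq_iff)
    have "(\<Sum>c<n. f (permute_upto i c y (b \<circ> ?t) \<circ> ?t))
      = f (permute_upto i x y (b \<circ> ?t)) + (\<Sum>c\<in>{..<n} - {x}. f (permute_upto (Suc i) c y b))"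
      by (subst sum.remove[of _ x]) (auto simp: eq eqx intro!: sum.cong)
    moreover have "(\<Sum>c<n. f (permute_upto (Suc i) c y b))
      = f (permute_upto (Suc i) x y b) + (\<Sum>c\<in>{..<n} - {x}. f (permute_upto (Suc i) c y b))"
      by (subst sum.remove[of _ x]) auto
    ultimately show ?thesis
      unfolding rec T1 T2 T3 T4 using False by simp
  qed
qed

text \<open>As for \<open>L_step\<close>, with $x = b_i$ and $y = b_{i+1}$: conjugating $L_{i-\frac12}$ by $s_i$ gives
  $n f(b) - \sum_c f(T^{i-1}_{c,y}\,b)$. For $x \ne y$ this is wrong only in the summand $c = x$. For $x = y$
  this sum cancels against the third term, and $L_i p_{i+\frac12}$ provides the required one.\<close>

lemma L_half_step:
  assumes i: "1 \<le> i" "i < k"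
    and L: "L k i \<in> partition_algebra k"
      "\<And>n f b. b \<in> labellings n k \<Longrightarrow> act n k (L k i) f b = (\<Sum>c<n. f (permute_upto i c (b i) b))"
    and L': "L_half k (i - 1) \<in> partition_algebra k"
      "\<And>n f b. b \<in> labellings n k \<Longrightarrow>
        act n k (L_half k (i - 1)) f b = int n * f b - (\<Sum>c<n. f (permute_upto (i - 1) c (b i) b))"
    and \<sigma>: "\<sigma>_half k i \<in> partition_algebra k"
      "\<And>n f b. b \<in> labellings n k \<Longrightarrow>
        act n k (\<sigma>_half k i) f b = f (permute_upto (i - 1) (b i) (b (Suc i)) b)"
    and b: "b \<in> labellings n k"
  shows "act n k (L_half k i) f b = int n * f b - (\<Sum>c<n. f (permute_upto i c (b (Suc i)) b))"
proof -
  let ?t = "transpose i (Suc i)"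
  define x y where "x = b i" and "y = b (Suc i)"
  have xy: "x < n" "y < n" using i b by (auto simp: x_def y_def intro: labellings_less)
  obtain j where j: "i = Suc j" using i by (cases i) auto
  have "Suc 0 \<le> i" "i \<le> k" "Suc i \<le> k" "i - Suc 0 \<le> k" "i - Suc 0 < i" "i - Suc 0 < Suc i"
    using i by simp_all
  note [simp] = this i L L'[unfolded One_nat_def] \<sigma>[unfolded One_nat_def] b xy x_def[symmetric] y_def[symmetric]
  have T1: "act n k (L k i \<cdot> p_half k i) f b = (if x = y then \<Sum>c<n. f (permute_upto i c x b) else 0)"
    by (simp cong: sum.cong_simp)
  have T2: "act n k (p_half k i \<cdot> L k i) f b = f (permute_upto i y x b)"
    by (simp cong: sum.cong_simp)
  have T3: "act n k (p_half k i \<cdot> L k i \<cdot> p k i \<cdot> p_half k i) f b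
      = (if x = y then \<Sum>c<n. f (permute_upto i y c (b(i := c))) else 0)"
    by (simp cong: sum.cong_simp)
  have T4: "act n k (s k i \<cdot> L_half k (i - 1) \<cdot> s k i) f b
      = int n * f (b \<circ> ?t \<circ> ?t) - (\<Sum>c<n. f (permute_upto (i - 1) c y (b \<circ> ?t) \<circ> ?t))"
    by (simp cong: sum.cong_simp)
  have tt: "b \<circ> ?t \<circ> ?t = b" by (simp add: comp_assoc)
  have T5: "permute_upto (i - 1) c d (b \<circ> ?t) \<circ> ?t = permute_upto (i - 1) c d b" for c d
    using j by (auto simp: permute_upto_def transpose_def fun_eq_iff)
  have rec: "act n k (L_half k i) f b =
      - act n k (L k i \<cdot> p_half k i) f b
      - act n k (p_half k i \<cdot> L k i) f b
      + act n k (p_half k i \<cdot> L k i \<cdot> p k i \<cdot> p_half k i) f b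
      + act n k (s k i \<cdot> L_half k (i - 1) \<cdot> s k i) f b
      + f (permute_upto (i - 1) x y b)"
    unfolding L_half_rec[OF i(1)] by (simp only: act_add act_diff act_uminus) (simp del: act_mult)
  show ?thesis
  proof (cases "x = y")
    case True
    then have "permute_upto i y c (b(i := c)) = permute_upto (i - 1) c y b" for c
      using x_def unfolding j by (auto simp: permute_upto_def transpose_def fun_eq_iff)
    then show ?thesis
      unfolding rec T1 T2 T3 T4 tt T5 using True by simp
  next
    case False
    have eq: "permute_upto (i - 1) c y b = permute_upto i c y b" if "c \<noteq> x" for c
      using that False x_def unfolding j by (auto simp: permute_upto_def transpose_def fun_eq_iff le_Suc_eq)
    have "(\<Sum>c<n. f (permute_upto (i - 1) c y b))
      = f (permute_upto (i - 1) x y b) + (\<Sum>c\<in>{..<n} - {x}. f (permute_upto i c y b))"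
      by (subst sum.remove[of _ x]) (use eq in \<open>auto intro!: sum.cong\<close>)
    moreover have "(\<Sum>c<n. f (permute_upto i c y b))
      = f (permute_upto i x y b) + (\<Sum>c\<in>{..<n} - {x}. f (permute_upto i c y b))"
      by (subst sum.remove[of _ x]) auto
    moreover have "permute_upto i y x b = permute_upto i x y b"
      unfolding permute_upto_def by (subst transpose_commute) (rule refl)
    ultimately show ?thesis
      unfolding rec T1 T2 T3 T4 tt T5 using False by simp
  qed
qed


text \<open>Write $x, y, u$ for the labels $b_{i-1}, b_i, b_{i+1}$. The conjugate of $\sigma_i$ acts like the desired
  operator, evaluating \<open>f\<close> at \<open>N\<close>, except that it leaves the entry \<open>x\<close> alone, evaluating \<open>f\<close> at \<open>M\<close>.
  The difference shows only if \<open>x\<close> is one of the exchanged labels. The remaining four terms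
  replace \<open>f M\<close> by \<open>f N\<close> once for $x = u$ and once for $x = y$; if both hold, then \<open>M\<close> and \<open>N\<close> coincide.\<close>

lemma \<sigma>_step:
  assumes i: "2 \<le> i" "i < k"
    and L: "L k (i - 1) \<in> partition_algebra k"
      "\<And>n f b. b \<in> labellings n k \<Longrightarrow>
        act n k (L k (i - 1)) f b = (\<Sum>c<n. f (permute_upto (i - 1) c (b (i - 1)) b))"
    and \<sigma>: "\<sigma> k i \<in> partition_algebra k"
      "\<And>n f b. b \<in> labellings n k \<Longrightarrow>
        act n k (\<sigma> k i) f b = f (permute_upto i (b (i - 1)) (b i) b)"
    and b: "b \<in> labellings n k"
  shows "act n k (\<sigma> k (Suc i)) f b = f (permute_upto (Suc i) (b i) (b (Suc i)) b)"
proof -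
  define j where "j = i - 1"
  then have j: "i = Suc j" "0 < j" using i by auto
  define x y u where "x = b j" and "y = b (Suc j)" and "u = b (Suc (Suc j))"
  have xyu: "x < n" "y < n" "u < n" using i j b by (auto simp: x_def y_def u_def intro: labellings_less)
  have "Suc 0 \<le> j" "j \<le> k" "j < k" "Suc j < k" "Suc j \<le> k" "Suc (Suc j) \<le> k" using i j by simp_all
  note [simp] = this L[folded j_def] \<sigma>[unfolded j] b xyu x_def[symmetric] y_def[symmetric] u_def[symmetric]
  define N where "N = permute_upto (Suc (Suc j)) y u b"
  define M where "M = N(j := x)"
  note defs = N_def M_def permute_upto_def transpose_def fun_eq_iff
  have T1: "act n k (s k j \<cdot> s k (Suc j) \<cdot> \<sigma> k (Suc j) \<cdot> s k (Suc j) \<cdot> s k j) f b = f M"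
  proof -
    let ?a = "permute_upto (Suc j) y u (b \<circ> transpose j (Suc j) \<circ> transpose (Suc j) (Suc (Suc j)))
       \<circ> transpose (Suc j) (Suc (Suc j)) \<circ> transpose j (Suc j)"
    have "act n k (s k j \<cdot> s k (Suc j) \<cdot> \<sigma> k (Suc j) \<cdot> s k (Suc j) \<cdot> s k j) f b = f ?a"
      by simp
    also have "?a = M" using j by (auto simp: defs)
    finally show ?thesis .
  qed
  have T2: "act n k (s k (Suc j) \<cdot> p_half k j \<cdot> L k j \<cdot> s k (Suc j) \<cdot> p_half k j \<cdot> s k (Suc j)) f b
      = (if x = u then f N else 0)"
  proof -
    let ?t = "transpose (Suc j) (Suc (Suc j))"
    have "act n k (s k (Suc j) \<cdot> p_half k j \<cdot> L k j \<cdot> s k (Suc j) \<cdot> p_half k j \<cdot> s k (Suc j)) f b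
      = (if x = u then f (permute_upto j y x (b \<circ> ?t \<circ> ?t) \<circ> ?t) else 0)"
      by (simp cong: sum.cong_simp)
    moreover have "permute_upto j y x (b \<circ> ?t \<circ> ?t) \<circ> ?t = N" if "x = u"
      using j that by (auto simp: defs)
    ultimately show ?thesis by simp
  qed
  have T3: "act n k (p_half k j \<cdot> L k j \<cdot> s k (Suc j) \<cdot> p_half k j) f b = (if x = y then f N else 0)"
  proof -
    let ?t = "transpose (Suc j) (Suc (Suc j))"
    have "act n k (p_half k j \<cdot> L k j \<cdot> s k (Suc j) \<cdot> p_half k j) f b
      = (if x = y then f (permute_upto j u x (b \<circ> ?t)) else 0)"
      by (simp cong: sum.cong_simp)
    moreover have "permute_upto j u x (b \<circ> ?t) = N" if "x = y"
      using j that by (auto simp: defs)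
    ultimately show ?thesis by simp
  qed
  have T4: "act n k (s k (Suc j) \<cdot> p_half k j \<cdot> L k j \<cdot> s k j \<cdot> p_half k (Suc j) \<cdot> p k (Suc j) \<cdot> p_half k j) f b
      = (if x = y then f M else 0)"
  proof -
    let ?t = "transpose (Suc j) (Suc (Suc j))"
    let ?a = "permute_upto j x u (b(Suc j := u) \<circ> transpose j (Suc j)) \<circ> ?t"
    have "act n k (s k (Suc j) \<cdot> p_half k j \<cdot> L k j \<cdot> s k j \<cdot> p_half k (Suc j) \<cdot> p k (Suc j) \<cdot> p_half k j) f b
      = (if x = y then f ?a else 0)"
      by (simp cong: sum.cong_simp)
    moreover have "?a = M" if "x = y"
      using j that by (auto simp: defs)
    ultimately show ?thesis by simp
  qed
  have T5: "act n k (p_half k j \<cdot> p k (Suc j) \<cdot> p_half k (Suc j) \<cdot> s k j \<cdot> L k j \<cdot> p_half k j \<cdot> s k (Suc j)) f b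
      = (if x = u then f M else 0)"
  proof -
    let ?t = "transpose (Suc j) (Suc (Suc j))"
    let ?a = "(permute_upto j y x (b \<circ> ?t) \<circ> transpose j (Suc j))(Suc j := u)"
    have "act n k (p_half k j \<cdot> p k (Suc j) \<cdot> p_half k (Suc j) \<cdot> s k j \<cdot> L k j \<cdot> p_half k j \<cdot> s k (Suc j)) f b
      = (if x = u then f ?a else 0)"
      by (simp cong: sum.cong_simp)
    moreover have "?a = M" if "x = u"
      using j that by (auto simp: defs)
    ultimately show ?thesis by simp
  qed
  have "N = M" if "x \<noteq> y" "x \<noteq> u" using j that by (auto simp: defs)
  moreover have "N = M" if "x = y" "x = u" using j that by (auto simp: defs)
  moreover have "act n k (\<sigma> k (Suc i)) f b = f M + (if x = u then f N else 0)
      + (if x = y then f N else 0) - (if x = y then f M else 0) - (if x = u then f M else 0)"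
    unfolding \<sigma>_rec[OF i(1), unfolded Suc_eq_plus1[symmetric]] unfolding act_add act_diff j_def[symmetric] unfolding j(1) T1 T2 T3 T4 T5 ..
  ultimately have "act n k (\<sigma> k (Suc i)) f b = f N" by (cases "x = y"; cases "x = u") simp_all
  then show ?thesis by (simp only: N_def y_def u_def j(1) diff_Suc_1)
qed

text \<open>The same cancellation as for \<open>\<sigma>_step\<close>. Now the entries \<open>y\<close> and \<open>u\<close> stay in place, and \<open>M\<close> and \<open>N\<close>
  again differ by whether the entry \<open>x\<close> takes part in the exchange of labels.\<close>

lemma \<sigma>_half_step:
  assumes i: "2 \<le> i" "i < k"
    and L: "L k (i - 1) \<in> partition_algebra k"
      "\<And>n f b. b \<in> labellings n k \<Longrightarrow>
        act n k (L k (i - 1)) f b = (\<Sum>c<n. f (permute_upto (i - 1) c (b (i - 1)) b))"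
    and \<sigma>: "\<sigma>_half k (i - 1) \<in> partition_algebra k"
      "\<And>n f b. b \<in> labellings n k \<Longrightarrow>
        act n k (\<sigma>_half k (i - 1)) f b = f (permute_upto (i - 2) (b (i - 1)) (b i) b)"
    and b: "b \<in> labellings n k"
  shows "act n k (\<sigma>_half k i) f b = f (permute_upto (i - 1) (b i) (b (Suc i)) b)"
proof -
  define j where "j = i - 1"
  then have j: "i = Suc j" "0 < j" using i by auto
  define x y u where "x = b j" and "y = b (Suc j)" and "u = b (Suc (Suc j))"
  have xyu: "x < n" "y < n" "u < n" using i j b by (auto simp: x_def y_def u_def intro: labellings_less)
  have facts: "Suc 0 \<le> j" "j \<le> k" "j < k" "Suc j < k" "Suc j \<le> k" "Suc (Suc j) \<le> k" "j - Suc 0 \<le> k" "j - Suc 0 < j" "j - Suc 0 < Suc j" "j - Suc 0 < Suc (Suc j)" using i j by simp_all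
  have "Suc j - 2 = j - Suc 0" by simp
  have le_j: "r \<le> j \<longleftrightarrow> r \<le> j - Suc 0 \<or> r = j" for r using j by auto
  note [simp] = facts L[folded j_def] \<sigma>[folded j_def, unfolded j \<open>Suc j - 2 = j - Suc 0\<close>] b xyu x_def[symmetric] y_def[symmetric] u_def[symmetric]
  define N where "N = permute_upto j y u b"
  define M where "M = permute_upto (j - 1) y u b"
  let ?t = "transpose (Suc j) (Suc (Suc j))"
  note defs = N_def M_def permute_upto_def transpose_def fun_eq_iff
  have T1: "act n k (s k j \<cdot> s k (Suc j) \<cdot> \<sigma>_half k j \<cdot> s k (Suc j) \<cdot> s k j) f b = f M"
  proof -
    let ?a = "permute_upto (j - Suc 0) y u (b \<circ> transpose j (Suc j) \<circ> ?t) \<circ> ?t \<circ> transpose j (Suc j)"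
    have "act n k (s k j \<cdot> s k (Suc j) \<cdot> \<sigma>_half k j \<cdot> s k (Suc j) \<cdot> s k j) f b = f ?a"
      by (simp cong: sum.cong_simp)
    moreover have "?a = M"
      using j by (auto simp: defs le_j)
    ultimately show ?thesis by simp
  qed
  have T2: "act n k (p_half k j \<cdot> L k j \<cdot> s k (Suc j) \<cdot> p_half k j \<cdot> s k (Suc j)) f b = (if x = u then f N else 0)"
  proof -
    let ?a = "permute_upto j y x (b \<circ> ?t \<circ> ?t)"
    have "act n k (p_half k j \<cdot> L k j \<cdot> s k (Suc j) \<cdot> p_half k j \<cdot> s k (Suc j)) f b = (if x = u then f ?a else 0)"
      by (simp cong: sum.cong_simp)
    moreover have "?a = N" if "x = u"
      using j that by (auto simp: defs le_j)
    ultimately show ?thesis by simp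
  qed
  have T3: "act n k (s k (Suc j) \<cdot> p_half k j \<cdot> L k j \<cdot> s k (Suc j) \<cdot> p_half k j) f b = (if x = y then f N else 0)"
  proof -
    let ?a = "permute_upto j u x (b \<circ> ?t) \<circ> ?t"
    have "act n k (s k (Suc j) \<cdot> p_half k j \<cdot> L k j \<cdot> s k (Suc j) \<cdot> p_half k j) f b = (if x = y then f ?a else 0)"
      by (simp cong: sum.cong_simp)
    moreover have "?a = N" if "x = y"
      using j that by (auto simp: defs le_j)
    ultimately show ?thesis by simp
  qed
  have T4: "act n k (p_half k j \<cdot> L k j \<cdot> s k j \<cdot> p_half k (Suc j) \<cdot> p k (Suc j) \<cdot> p_half k j) f b = (if x = y then f M else 0)"
  proof -
    let ?a = "permute_upto j x u (b(Suc j := u) \<circ> transpose j (Suc j))"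
    have "act n k (p_half k j \<cdot> L k j \<cdot> s k j \<cdot> p_half k (Suc j) \<cdot> p k (Suc j) \<cdot> p_half k j) f b = (if x = y then f ?a else 0)"
      by (simp cong: sum.cong_simp)
    moreover have "?a = M" if "x = y"
      using j that by (auto simp: defs le_j)
    ultimately show ?thesis by simp
  qed
  have T5: "act n k (s k (Suc j) \<cdot> p_half k j \<cdot> p k (Suc j) \<cdot> p_half k (Suc j) \<cdot> s k j \<cdot> L k j \<cdot> p_half k j \<cdot> s k (Suc j)) f b = (if x = u then f M else 0)"
  proof -
    let ?a = "(permute_upto j y x (b \<circ> ?t) \<circ> transpose j (Suc j))(Suc j := u) \<circ> ?t"
    have "act n k (s k (Suc j) \<cdot> p_half k j \<cdot> p k (Suc j) \<cdot> p_half k (Suc j) \<cdot> s k j \<cdot> L k j \<cdot> p_half k j \<cdot> s k (Suc j)) f b = (if x = u then f ?a else 0)"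
      by (simp cong: sum.cong_simp)
    moreover have "?a = M" if "x = u"
    proof
      fix r
      consider "r = j" | "r = Suc j" | "r = Suc (Suc j)" | "r < j" | "r > Suc (Suc j)" by linarith
      then show "?a r = M r" using j that by cases (auto simp: M_def permute_upto_def transpose_def)
    qed
    ultimately show ?thesis by simp
  qed
  have "N = M" if "x \<noteq> y" "x \<noteq> u" using j that by (auto simp: defs le_j)
  moreover have "N = M" if "x = y" "x = u" using j that by (auto simp: defs)
  moreover have "act n k (\<sigma>_half k i) f b = f M + (if x = u then f N else 0)
      + (if x = y then f N else 0) - (if x = y then f M else 0) - (if x = u then f M else 0)"
    unfolding \<sigma>_half_rec[OF i(1)] unfolding act_add act_diff j_def[symmetric] unfolding j(1) T1 T2 T3 T4 T5 ..
  ultimately have "act n k (\<sigma>_half k i) f b = f N" by (cases "x = y"; cases "x = u") simp_all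
  then show ?thesis by (simp only: N_def y_def u_def j(1) diff_Suc_1)
qed

section \<open>Closed forms of the recursively defined elements\<close>

text \<open>The two recursions refer to each other, so the closed forms of $L_i$ and $\sigma_i$ are established
  by a common induction.\<close>

lemma L_and_\<sigma>_action:
  assumes "i \<le> k"
  shows "L k i \<in> partition_algebra k \<and> \<sigma> k i \<in> partition_algebra k
    \<and> (1 \<le> i \<longrightarrow> (\<forall>n f. \<forall>b\<in>labellings n k.
          act n k (L k i) f b = (\<Sum>c<n. f (permute_upto i c (b i) b))))
    \<and> (2 \<le> i \<longrightarrow> (\<forall>n f. \<forall>b\<in>labellings n k.
          act n k (\<sigma> k i) f b = f (permute_upto i (b (i - 1)) (b i) b)))"
  using assms
proof (induction i rule: less_induct)
  case (less i)
  consider "i = 0" | "i = 1" | m where "i = Suc m" "1 \<le> m"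
    by (metis One_nat_def Suc_leI not0_implies_Suc not_gr0)
  then show ?case
  proof cases
    case 1
    then show ?thesis by simp
  next
    case 2
    have eq: "b(Suc 0 := c) = permute_upto (Suc 0) c (b (Suc 0)) b" for b c
      by (auto simp: permute_upto_def fun_eq_iff)
    show ?thesis using 2 less.prems by (simp add: eq)
  next
    case 3
    then have m: "1 \<le> m" "m < k" using less.prems by auto
    have L: "L k m \<in> partition_algebra k"
      "\<And>n f b. b \<in> labellings n k \<Longrightarrow> act n k (L k m) f b = (\<Sum>c<n. f (permute_upto m c (b m) b))"
      using less.IH[of m] 3 m by auto
    have \<sigma>: "\<sigma> k (Suc m) \<in> partition_algebra k \<and> (\<forall>n f. \<forall>b\<in>labellings n k.
        act n k (\<sigma> k (Suc m)) f b = f (permute_upto (Suc m) (b m) (b (Suc m)) b))"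
    proof (cases "m = 1")
      case True
      have eq: "b \<circ> transpose (Suc 0) (Suc (Suc 0))
          = permute_upto (Suc (Suc 0)) (b (Suc 0)) (b (Suc (Suc 0))) b" for b :: "nat \<Rightarrow> nat"
        by (auto simp: permute_upto_def transpose_def fun_eq_iff le_Suc_eq)
      show ?thesis using True m by (simp add: eq)
    next
      case False
      then have m2: "2 \<le> m" using m by simp
      have IH: "L k (m - 1) \<in> partition_algebra k" "\<sigma> k m \<in> partition_algebra k"
        "\<And>n f b. b \<in> labellings n k \<Longrightarrow>
          act n k (L k (m - 1)) f b = (\<Sum>c<n. f (permute_upto (m - 1) c (b (m - 1)) b))"
        "\<And>n f b. b \<in> labellings n k \<Longrightarrow>
          act n k (\<sigma> k m) f b = f (permute_upto m (b (m - 1)) (b m) b)"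
        using less.IH[of m] less.IH[of "m - 1"] 3 m m2 by auto
      have "\<sigma> k (Suc m) \<in> partition_algebra k"
        unfolding \<sigma>_rec[OF m2, unfolded Suc_eq_plus1[symmetric]]
        by (intro partition_algebra_add partition_algebra_diff partition_algebra_mult IH(1,2)
            s_in_partition_algebra p_in_partition_algebra p_half_in_partition_algebra)
          (use m m2 in auto)
      moreover have "act n k (\<sigma> k (Suc m)) f b = f (permute_upto (Suc m) (b m) (b (Suc m)) b)"
        if "b \<in> labellings n k" for n f b
        using \<sigma>_step[OF m2 m(2) IH(1,3,2,4) that] .
      ultimately show ?thesis by blast
    qed
    have "L k (Suc m) \<in> partition_algebra k"
      unfolding L_rec[OF m(1), unfolded Suc_eq_plus1[symmetric]]
      by (intro partition_algebra_add partition_algebra_diff partition_algebra_mult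
          partition_algebra_uminus L(1) conjunct1[OF \<sigma>]
          s_in_partition_algebra p_in_partition_algebra p_half_in_partition_algebra)
        (use m in auto)
    moreover have "act n k (L k (Suc m)) f b = (\<Sum>c<n. f (permute_upto (Suc m) c (b (Suc m)) b))"
      if "b \<in> labellings n k" for n f b
      by (rule L_step[OF m L _ _ that]) (use \<sigma> in auto)
    ultimately show ?thesis using \<sigma> 3 by simp
  qed
qed

lemma L_in_partition_algebra [simp]: "i \<le> k \<Longrightarrow> L k i \<in> partition_algebra k"
  using L_and_\<sigma>_action by blast

lemma \<sigma>_in_partition_algebra [simp]: "i \<le> k \<Longrightarrow> \<sigma> k i \<in> partition_algebra k"
  using L_and_\<sigma>_action by blast

lemma act_L:
  "1 \<le> i \<Longrightarrow> i \<le> k \<Longrightarrow> b \<in> labellings n k \<Longrightarrow>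
    act n k (L k i) f b = (\<Sum>c<n. f (permute_upto i c (b i) b))"
  using L_and_\<sigma>_action by blast

lemma act_\<sigma>:
  assumes "1 \<le> i" "i < k" "b \<in> labellings n k"
  shows "act n k (\<sigma> k (Suc i)) f b = f (permute_upto (Suc i) (b i) (b (Suc i)) b)"
  using L_and_\<sigma>_action[of "Suc i" k] assms by simp

lemma \<sigma>_half_action:
  assumes "i < k"
  shows "\<sigma>_half k i \<in> partition_algebra k \<and> (1 \<le> i \<longrightarrow> (\<forall>n f. \<forall>b\<in>labellings n k.
    act n k (\<sigma>_half k i) f b = f (permute_upto (i - 1) (b i) (b (Suc i)) b)))"
  using assms
proof (induction i)
  case 0
  then show ?case by simp
next
  case (Suc m)
  show ?case
  proof (cases "m = 0")
    case True
    have "permute_upto 0 c d b = b" for c d b by (simp add: permute_upto_def)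
    then show ?thesis using True by simp
  next
    case False
    then have i: "2 \<le> Suc m" by simp
    have \<sigma>: "\<sigma>_half k (Suc m - 1) \<in> partition_algebra k"
      "\<And>n f b. b \<in> labellings n k \<Longrightarrow>
        act n k (\<sigma>_half k (Suc m - 1)) f b = f (permute_upto (Suc m - 2) (b (Suc m - 1)) (b (Suc m)) b)"
      using Suc False by (simp_all add: Suc_le_eq numeral_2_eq_2)
    have L: "L k (Suc m - 1) \<in> partition_algebra k"
      "\<And>n f b. b \<in> labellings n k \<Longrightarrow>
        act n k (L k (Suc m - 1)) f b = (\<Sum>c<n. f (permute_upto (Suc m - 1) c (b (Suc m - 1)) b))"
      using Suc.prems False by (auto simp: act_L)
    have "\<sigma>_half k (Suc m) \<in> partition_algebra k"
      unfolding \<sigma>_half_rec[OF i]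
      by (intro partition_algebra_add partition_algebra_diff partition_algebra_mult L(1) \<sigma>(1)
          s_in_partition_algebra p_in_partition_algebra p_half_in_partition_algebra)
        (use Suc.prems False in auto)
    then show ?thesis using \<sigma>_half_step[OF i Suc.prems L \<sigma>] by blast
  qed
qed

lemma L_half_action:
  assumes "i < k"
  shows "L_half k i \<in> partition_algebra k \<and> (\<forall>n f. \<forall>b\<in>labellings n k.
    act n k (L_half k i) f b = int n * f b - (\<Sum>c<n. f (permute_upto i c (b (Suc i)) b)))"
  using assms
proof (induction i)
  case 0
  have "permute_upto 0 c d b = b" for c d b by (simp add: permute_upto_def)
  then show ?case by simp
next
  case (Suc m)
  have i: "1 \<le> Suc m" by simp
  have L: "L k (Suc m) \<in> partition_algebra k"
    "\<And>n f b. b \<in> labellings n k \<Longrightarrow>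
      act n k (L k (Suc m)) f b = (\<Sum>c<n. f (permute_upto (Suc m) c (b (Suc m)) b))"
    using Suc.prems by (auto simp: act_L)
  have L': "L_half k (Suc m - 1) \<in> partition_algebra k"
    "\<And>n f b. b \<in> labellings n k \<Longrightarrow> act n k (L_half k (Suc m - 1)) f b
      = int n * f b - (\<Sum>c<n. f (permute_upto (Suc m - 1) c (b (Suc m)) b))"
    using Suc by simp_all
  have \<sigma>: "\<sigma>_half k (Suc m) \<in> partition_algebra k"
    "\<And>n f b. b \<in> labellings n k \<Longrightarrow>
      act n k (\<sigma>_half k (Suc m)) f b = f (permute_upto (Suc m - 1) (b (Suc m)) (b (Suc (Suc m))) b)"
    using \<sigma>_half_action[OF Suc.prems] by auto
  have "L_half k (Suc m) \<in> partition_algebra k"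
    unfolding L_half_rec[OF i]
    by (intro partition_algebra_add partition_algebra_diff partition_algebra_mult
        partition_algebra_uminus L(1) L'(1) \<sigma>(1)
        s_in_partition_algebra p_in_partition_algebra p_half_in_partition_algebra)
      (use Suc.prems in auto)
  then show ?case using L_half_step[OF i Suc.prems L L' \<sigma>] by blast
qed

section \<open>Operators commuting with the closed forms\<close>

definition equivariant :: "nat \<Rightarrow> nat \<Rightarrow> element \<Rightarrow> bool" where
  "equivariant k m x \<longleftrightarrow> (\<forall>n c d f. \<forall>b\<in>labellings n k. c < n \<longrightarrow> d < n \<longrightarrow>
     act n k x (\<lambda>a. f (permute_upto m c d a)) b = act n k x f (permute_upto m c d b))"

text \<open>The matrix of \<open>x\<close> vanishes at \<open>(a, b)\<close> unless $a_j = b_j$, expressed without mentioning matrix entries.\<close>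

definition preserves_entry :: "nat \<Rightarrow> nat \<Rightarrow> element \<Rightarrow> bool" where
  "preserves_entry k j x \<longleftrightarrow> (\<forall>n f g. \<forall>b\<in>labellings n k.
     (\<forall>a\<in>labellings n k. a j = b j \<longrightarrow> f a = g a) \<longrightarrow> act n k x f b = act n k x g b)"

lemma equivariantD:
  "equivariant k m x \<Longrightarrow> b \<in> labellings n k \<Longrightarrow> c < n \<Longrightarrow> d < n \<Longrightarrow>
    act n k x (\<lambda>a. f (permute_upto m c d a)) b = act n k x f (permute_upto m c d b)"
  unfolding equivariant_def by blast

lemma preserves_entryD:
  "preserves_entry k j x \<Longrightarrow> b \<in> labellings n k \<Longrightarrow>
    (\<And>a. a \<in> labellings n k \<Longrightarrow> a j = b j \<Longrightarrow> f a = g a) \<Longrightarrow> act n k x f b = act n k x g b"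
  unfolding preserves_entry_def by blast

lemma act_sum_function:
  "act n k x (\<lambda>a. \<Sum>i\<in>A. g i a) b = (\<Sum>i\<in>A. act n k x (g i) b)"
  unfolding act_def diagram_act_sum sum_distrib_left by (rule sum.swap)

lemma act_diff_function:
  "act n k x (\<lambda>a. g a - h a) b = act n k x g b - act n k x h b"
  unfolding act_def diagram_act_def by (simp add: sum_subtractf right_diff_distrib)

lemma act_scale_function:
  "act n k x (\<lambda>a. r * g a) b = r * act n k x g b"
  unfolding act_def diagram_act_scale by (simp add: sum_distrib_left mult_ac)

text \<open>Although the exchanged label \<open>a j\<close> depends on the labelling, an operator that preserves entry \<open>j\<close> sees
  it as the constant \<open>b j\<close>, and equivariance applies.\<close>

lemma act_permute_sum:
  assumes "equivariant k m x" "preserves_entry k j x" and b: "b \<in> labellings n k"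
    and j: "1 \<le> j" "j \<le> k"
  shows "act n k x (\<lambda>a. \<Sum>c<n. f (permute_upto m c (a j) a)) b
    = (\<Sum>c<n. act n k x f (permute_upto m c (b j) b))"
proof -
  have "act n k x (\<lambda>a. \<Sum>c<n. f (permute_upto m c (a j) a)) b
    = act n k x (\<lambda>a. \<Sum>c<n. f (permute_upto m c (b j) a)) b"
    by (rule preserves_entryD[OF assms(2) b]) simp
  also have "\<dots> = (\<Sum>c<n. act n k x f (permute_upto m c (b j) b))"
    unfolding act_sum_function
    by (intro sum.cong refl equivariantD[OF assms(1) b]) (use b j in \<open>auto simp: labellings_less\<close>)
  finally show ?thesis .
qed

lemma commutes_L:
  assumes x: "x \<in> partition_algebra k" "equivariant k i x" "preserves_entry k i x"
    and i: "1 \<le> i" "i \<le> k"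
  shows "commutes (L k i) x"
proof (rule commutesI)
  fix n f b assume b: "b \<in> labellings n k"
  have "act n k x (act n k (L k i) f) b = act n k x (\<lambda>a. \<Sum>c<n. f (permute_upto i c (a i) a)) b"
    by (rule preserves_entryD[OF x(3) b]) (simp add: act_L[OF i])
  also have "\<dots> = (\<Sum>c<n. act n k x f (permute_upto i c (b i) b))"
    using x b i by (intro act_permute_sum)
  also have "\<dots> = act n k (L k i) (act n k x f) b"
    using i b by (simp add: act_L)
  finally show "act n k (L k i) (act n k x f) b = act n k x (act n k (L k i) f) b" ..
qed (use x i in auto)

lemma commutes_L_half:
  assumes x: "x \<in> partition_algebra k" "equivariant k i x" "preserves_entry k (Suc i) x"
    and i: "i < k"
  shows "commutes (L_half k i) x"
proof (rule commutesI)
  fix n f b assume b: "b \<in> labellings n k"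
  note act_L_half = L_half_action[OF i, THEN conjunct2, rule_format]
  have "act n k x (act n k (L_half k i) f) b
    = act n k x (\<lambda>a. int n * f a - (\<Sum>c<n. f (permute_upto i c (a (Suc i)) a))) b"
    by (rule preserves_entryD[OF x(3) b]) (simp add: act_L_half)
  also have "\<dots> = int n * act n k x f b - (\<Sum>c<n. act n k x f (permute_upto i c (b (Suc i)) b))"
    unfolding act_diff_function act_scale_function using x b i
    by (subst act_permute_sum) auto
  also have "\<dots> = act n k (L_half k i) (act n k x f) b"
    using b by (simp add: act_L_half)
  finally show "act n k (L_half k i) (act n k x f) b = act n k x (act n k (L_half k i) f) b" ..
qed (use x i L_half_action in auto)

lemma act_permute_entries:
  assumes x: "equivariant k m x" "preserves_entry k i x" "preserves_entry k j x"
    and b: "b \<in> labellings n k" and ij: "1 \<le> i" "i \<le> k" "1 \<le> j" "j \<le> k"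
    and g: "\<And>a. a \<in> labellings n k \<Longrightarrow> g a = f (permute_upto m (a i) (a j) a)"
  shows "act n k x g b = act n k x f (permute_upto m (b i) (b j) b)"
proof -
  have "act n k x g b = act n k x (\<lambda>a. f (permute_upto m (b i) (a j) a)) b"
    by (rule preserves_entryD[OF x(2) b]) (simp add: g)
  also have "\<dots> = act n k x (\<lambda>a. f (permute_upto m (b i) (b j) a)) b"
    by (rule preserves_entryD[OF x(3) b]) simp
  also have "\<dots> = act n k x f (permute_upto m (b i) (b j) b)"
    by (rule equivariantD[OF x(1) b]) (use b ij in \<open>auto simp: labellings_less\<close>)
  finally show ?thesis .
qed

lemma commutes_\<sigma>:
  assumes x: "x \<in> partition_algebra k" "equivariant k (Suc i) x"
      "preserves_entry k i x" "preserves_entry k (Suc i) x"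
    and i: "1 \<le> i" "i < k"
  shows "commutes (\<sigma> k (Suc i)) x"
proof (rule commutesI)
  fix n f b assume b: "b \<in> labellings n k"
  have "act n k x (act n k (\<sigma> k (Suc i)) f) b = act n k x f (permute_upto (Suc i) (b i) (b (Suc i)) b)"
    using x b i by (intro act_permute_entries) (auto simp: act_\<sigma>)
  then show "act n k (\<sigma> k (Suc i)) (act n k x f) b = act n k x (act n k (\<sigma> k (Suc i)) f) b"
    using b i by (simp add: act_\<sigma>)
qed (use x i in auto)

lemma commutes_\<sigma>_half:
  assumes x: "x \<in> partition_algebra k" "equivariant k (i - 1) x"
      "preserves_entry k i x" "preserves_entry k (Suc i) x"
    and i: "1 \<le> i" "i < k"
  shows "commutes (\<sigma>_half k i) x"
proof (rule commutesI)
  fix n f b assume b: "b \<in> labellings n k"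
  have act: "act n k (\<sigma>_half k i) f b = f (permute_upto (i - 1) (b i) (b (Suc i)) b)"
    if "b \<in> labellings n k" for f b
    using \<sigma>_half_action[OF i(2)] i(1) that by blast
  have "act n k x (act n k (\<sigma>_half k i) f) b = act n k x f (permute_upto (i - 1) (b i) (b (Suc i)) b)"
    using x b i by (intro act_permute_entries act) auto
  then show "act n k (\<sigma>_half k i) (act n k x f) b = act n k x (act n k (\<sigma>_half k i) f) b"
    using act[OF b] by simp
qed (use x i \<sigma>_half_action in auto)

section \<open>Equivariance and preserved entries\<close>

text \<open>Conjugating a transposition by a transposition transposes the images; \<open>i \<le> m\<close> ensures that the
  outer exchange acts on all entries that the inner one affects.\<close>

lemma permute_upto_permute_upto:
  assumes "i \<le> m"
  shows "permute_upto m c d (permute_upto i e h b)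
    = permute_upto i (transpose c d e) (transpose c d h) (permute_upto m c d b)"
proof
  fix r
  have "transpose c d (transpose e h v) = transpose (transpose c d e) (transpose c d h) (transpose c d v)" for v
    by (auto simp: transpose_def)
  then show "permute_upto m c d (permute_upto i e h b) r
    = permute_upto i (transpose c d e) (transpose c d h) (permute_upto m c d b) r"
    using assms by (simp add: permute_upto_def)
qed

lemma bij_betw_transpose_lessThan:
  "c < n \<Longrightarrow> d < n \<Longrightarrow> bij_betw (transpose c d) {..<n} {..<n}"
  by (rule bij_betw_byWitness[where f' = "transpose c d"]) (auto simp: transpose_def)

text \<open>The outer exchange turns the summation index \<open>e\<close> into \<open>transpose c d e\<close>, which runs through the same
  labels. So the operators of $L_i$ and $L_{i+\frac12}$ are equivariant.\<close>

lemma sum_permute_upto: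
  assumes "i \<le> m" "1 \<le> j" "j \<le> m" "c < n" "d < n"
  shows "(\<Sum>e<n. f (permute_upto m c d (permute_upto i e (b j) b)))
    = (\<Sum>e<n. f (permute_upto i e (permute_upto m c d b j) (permute_upto m c d b)))"
proof -
  have "permute_upto m c d b j = transpose c d (b j)" using assms by simp
  then show ?thesis
    using sum.reindex_bij_betw[OF bij_betw_transpose_lessThan[OF assms(4,5)],
        of "\<lambda>e. f (permute_upto i e (transpose c d (b j)) (permute_upto m c d b))"]
    by (simp add: permute_upto_permute_upto[OF assms(1)])
qed

lemma equivariant_L:
  assumes "1 \<le> i" "i \<le> m" "m \<le> k"
  shows "equivariant k m (L k i)"
  unfolding equivariant_def
proof (intro allI ballI impI)
  fix n c d f b assume "b \<in> labellings n k" "c < n" "d < n"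
  then show "act n k (L k i) (\<lambda>a. f (permute_upto m c d a)) b = act n k (L k i) f (permute_upto m c d b)"
    using assms by (simp only: act_L permute_upto_in_labellings le_trans[of i m k] sum_permute_upto[of i m i])
qed

lemma equivariant_L_half:
  assumes "i < m" "m \<le> k"
  shows "equivariant k m (L_half k i)"
  unfolding equivariant_def
proof (intro allI ballI impI)
  fix n c d f b assume b: "b \<in> labellings n k" "c < n" "d < n"
  have i: "i < k" using assms by simp
  note act_L_half = L_half_action[OF i, THEN conjunct2, rule_format]
  have "permute_upto m c d b \<in> labellings n k" using b assms by simp
  then show "act n k (L_half k i) (\<lambda>a. f (permute_upto m c d a)) b
    = act n k (L_half k i) f (permute_upto m c d b)"
    using sum_permute_upto[of i m "Suc i" c n d f b] assms b by (simp only: act_L_half)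
qed

lemma preserves_entry_L:
  assumes "1 \<le> i" "i < j" "j \<le> k"
  shows "preserves_entry k j (L k i)"
  unfolding preserves_entry_def
proof (intro allI ballI impI)
  fix n f g b assume b: "b \<in> labellings n k"
    and fg: "\<forall>a\<in>labellings n k. a j = b j \<longrightarrow> f a = (g a :: int)"
  then show "act n k (L k i) f b = act n k (L k i) g b"
    using assms by (auto simp: act_L labellings_less intro!: sum.cong)
qed

lemma preserves_entry_L_half:
  assumes "i < j" "j \<le> k"
  shows "preserves_entry k j (L_half k i)"
  unfolding preserves_entry_def
proof (intro allI ballI impI)
  fix n f g b assume b: "b \<in> labellings n k"
    and fg: "\<forall>a\<in>labellings n k. a j = b j \<longrightarrow> f a = (g a :: int)"
  have i: "i < k" using assms by simp
  have "(\<Sum>c<n. f (permute_upto i c (b (Suc i)) b)) = (\<Sum>c<n. g (permute_upto i c (b (Suc i)) b))"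
    using assms b fg by (auto simp: labellings_less intro!: sum.cong)
  moreover have "f b = g b" using b fg by simp
  ultimately show "act n k (L_half k i) f b = act n k (L_half k i) g b"
    using L_half_action[OF i] b by simp
qed

lemma act_embed:
  "act n k (embed j k x) f b = (\<Sum>\<rho>\<in>Poly_Mapping.keys x.
     poly (Poly_Mapping.lookup x \<rho>) (int n) * diagram_act n k (\<rho> \<union> strand ` {j<..k}) f b)"
  by (simp add: embed_def act_sum)

lemma embed_in_partition_algebra:
  assumes "Poly_Mapping.keys x \<subseteq> diagrams j" "j \<le> k"
  shows "embed j k x \<in> partition_algebra k"
proof -
  have "scale r (basis (\<rho> \<union> strand ` {j<..k})) \<in> partition_algebra k" if "\<rho> \<in> Poly_Mapping.keys x" for r \<rho>
  proof -
    have "partition_on (rows {1..j}) \<rho>"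
      using assms that by (auto simp: diagrams_def rows_def vertices_def)
    then have "\<rho> \<union> strand ` {j<..k} \<in> diagrams k"
      by (rule Un_strands_in_diagrams) (use assms(2) in auto)
    then show ?thesis
      using keys_scale[of r "basis (\<rho> \<union> strand ` {j<..k})"] partition_algebra_basis
      by (fastforce simp: partition_algebra_def)
  qed
  then have "(\<Sum>\<rho>\<in>A. scale (Poly_Mapping.lookup x \<rho>) (basis (\<rho> \<union> strand ` {j<..k}))) \<in> partition_algebra k"
    if "A \<subseteq> Poly_Mapping.keys x" for A
    using that by (induction A rule: infinite_finite_induct) auto
  then show ?thesis unfolding embed_def by simp
qed

lemma permute_upto_involutory [simp]: "permute_upto m c d (permute_upto m c d a) = a"
  by (auto simp: permute_upto_def)

text \<open>The blocks of a diagram on \<open>j\<close> strands have all their labels exchanged, and in an added strand both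
  ends are treated alike; since a transposition is injective, monochromatic blocks are
  preserved either way.\<close>

lemma equivariant_embed:
  assumes x: "Poly_Mapping.keys x \<subseteq> diagrams j" and m: "j \<le> m" "m \<le> k"
  shows "equivariant k m (embed j k x)"
  unfolding equivariant_def
proof (intro allI ballI impI)
  fix n c d f b assume b: "b \<in> labellings n k" "c < n" "d < n"
  let ?P = "permute_upto m c d"
  have "diagram_act n k (\<rho> \<union> strand ` {j<..k}) (\<lambda>a. f (?P a)) b
    = diagram_act n k (\<rho> \<union> strand ` {j<..k}) f (?P b)" if \<rho>: "\<rho> \<in> Poly_Mapping.keys x" for \<rho>
  proof -
    have "label (?P a) (?P b) u = transpose c d (label a b u)" if "u \<in> vertices j" for a b u
      using that m by (auto simp: vertices_def permute_upto_def)
    moreover have "u \<in> vertices j" if "B \<in> \<rho>" "u \<in> B" for B u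
      using that x \<rho> by (auto simp: diagrams_def partition_on_def)
    ultimately have "label (?P a) (?P b) u = transpose c d (label a b u)" if "B \<in> \<rho>" "u \<in> B" for a b u B
      using that by blast
    moreover have inj: "transpose c d v = transpose c d w \<longleftrightarrow> v = w" for v w
      by (metis transpose_involutory)
    ultimately have "monochromatic (label (?P a) (?P b)) \<rho> \<longleftrightarrow> monochromatic (label a b) \<rho>" for a b
      unfolding monochromatic_def by (simp cong: ball_cong)
    moreover have "?P a r = ?P b r \<longleftrightarrow> a r = b r" for a b r
      by (simp add: permute_upto_def inj)
    ultimately have mono: "monochromatic (label (?P a) (?P b)) (\<rho> \<union> strand ` {j<..k})
        \<longleftrightarrow> monochromatic (label a b) (\<rho> \<union> strand ` {j<..k})" for a b
      unfolding monochromatic_Un_strands by simp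
    have mono': "monochromatic (label a (?P b)) (\<rho> \<union> strand ` {j<..k})
        \<longleftrightarrow> monochromatic (label (?P a) b) (\<rho> \<union> strand ` {j<..k})" for a
      using mono[of a "?P b"] by simp
    show ?thesis
      unfolding diagram_act_def
      by (rule sum.reindex_bij_witness[where i = ?P and j = ?P]) (use b m mono mono' in auto)
  qed
  then show "act n k (embed j k x) (\<lambda>a. f (?P a)) b = act n k (embed j k x) f (?P b)"
    unfolding act_embed by simp
qed

lemma preserves_entry_embed:
  assumes x: "\<And>\<rho> a b. \<rho> \<in> Poly_Mapping.keys x \<Longrightarrow>
    monochromatic (label a b) (\<rho> \<union> strand ` {j<..k}) \<Longrightarrow> a r = b r"
  shows "preserves_entry k r (embed j k x)"
  unfolding preserves_entry_def act_embed diagram_act_def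
  using x by (fastforce intro!: sum.cong arg_cong[of _ _ "\<lambda>t. _ * t"])

lemma preserves_entry_embed_above:
  "j < r \<Longrightarrow> r \<le> k \<Longrightarrow> preserves_entry k r (embed j k x)"
  by (rule preserves_entry_embed) (unfold monochromatic_Un_strands, auto)

lemma preserves_entry_embed_half:
  assumes "Poly_Mapping.keys x \<subseteq> half_diagrams j"
  shows "preserves_entry k j (embed j k x)"
proof (rule preserves_entry_embed)
  fix \<rho> a b assume "\<rho> \<in> Poly_Mapping.keys x" and m: "monochromatic (label a b) (\<rho> \<union> strand ` {j<..k})"
  then obtain B where "B \<in> \<rho>" "Top j \<in> B" "Bot j \<in> B"
    using assms by (auto simp: half_diagrams_def)
  then have "label a b (Top j) = label a b (Bot j)"
    using m unfolding monochromatic_Un_strands monochromatic_def by blast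
  then show "a j = b j" by simp
qed

section \<open>Commutation relations\<close>

lemma commutes_sym: "commutes x y \<Longrightarrow> commutes y x"
  by (simp add: commutes_def)

lemma commutes_0: "commutes 0 x"
  by (simp add: commutes_def mult_def)

lemma commutes_L_L:
  assumes "i < j" "j \<le> k"
  shows "commutes (L k j) (L k i)"
proof (cases "i = 0")
  case True
  then show ?thesis using commutes_sym[OF commutes_0] by simp
next
  case False
  with assms show ?thesis by (intro commutes_L equivariant_L preserves_entry_L) auto
qed

lemma commutes_L_L_half:
  assumes "i \<le> k" "j < k"
  shows "commutes (L k i) (L_half k j)"
proof (cases "i = 0")
  case True
  then show ?thesis using commutes_0 by simp
next
  case False
  show ?thesis
  proof (cases "i \<le> j")
    case True
    with False assms show ?thesis
      by (intro commutes_sym[OF commutes_L_half] equivariant_L preserves_entry_L) auto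
  next
    case False
    with assms show ?thesis
      by (intro commutes_L equivariant_L_half preserves_entry_L_half) (auto simp: L_half_action)
  qed
qed

lemma commutes_L_half_L_half:
  "i < j \<Longrightarrow> j < k \<Longrightarrow> commutes (L_half k j) (L_half k i)"
  by (intro commutes_L_half equivariant_L_half preserves_entry_L_half) (auto simp: L_half_action)

theorem theorem3p8:
  fixes k :: nat
  shows "(\<forall>i::nat. 1 \<le> i \<and> i + 1 \<le> k \<longrightarrow>
            ((\<forall>x \<in> half_partition_algebra (i + 1). commutes (L k (i + 1)) (embed (i + 1) k x)) \<and>
             (\<forall>x \<in> half_partition_algebra i. commutes (\<sigma> k (i + 1)) (embed i k x))) \<and>
            ((\<forall>x \<in> partition_algebra i. commutes (L_half k i) (embed i k x)) \<and>
             (\<forall>x \<in> partition_algebra (i - 1). commutes (\<sigma>_half k i) (embed (i - 1) k x)))) \<and>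
         pairwise commutes ({L k i |i. i \<le> k} \<union> {L_half k i |i. i + 1 \<le> k})"
proof (intro conjI allI impI ballI)
  fix i assume i: "1 \<le> i \<and> i + 1 \<le> k"
  have half: "Poly_Mapping.keys x \<subseteq> half_diagrams j \<and> Poly_Mapping.keys x \<subseteq> diagrams j"
    if "x \<in> half_partition_algebra j" for x j
    using keys_half_partition_algebra[OF that] by (auto simp: half_diagrams_def)
  show "commutes (L k (i + 1)) (embed (i + 1) k x)" if "x \<in> half_partition_algebra (i + 1)" for x
    using i half[OF that]
    by (intro commutes_L embed_in_partition_algebra equivariant_embed preserves_entry_embed_half) auto
  show "commutes (\<sigma> k (i + 1)) (embed i k x)" if "x \<in> half_partition_algebra i" for x
    using i half[OF that] unfolding Suc_eq_plus1[symmetric]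
    by (intro commutes_\<sigma> embed_in_partition_algebra equivariant_embed preserves_entry_embed_half
        preserves_entry_embed_above) auto
  show "commutes (L_half k i) (embed i k x)" if "x \<in> partition_algebra i" for x
    using i that unfolding partition_algebra_def
    by (intro commutes_L_half embed_in_partition_algebra equivariant_embed preserves_entry_embed_above) auto
  show "commutes (\<sigma>_half k i) (embed (i - 1) k x)" if "x \<in> partition_algebra (i - 1)" for x
    using i that unfolding partition_algebra_def
    by (intro commutes_\<sigma>_half embed_in_partition_algebra equivariant_embed preserves_entry_embed_above) auto
next
  have LL: "commutes (L k i) (L k j)" if "i \<le> k" "j \<le> k" "i \<noteq> j" for i j
    using that commutes_L_L[of i j k] commutes_L_L[of j i k] commutes_sym by (cases i j rule: linorder_cases) auto
  have hh: "commutes (L_half k i) (L_half k j)" if "i < k" "j < k" "i \<noteq> j" for i j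
    using that commutes_L_half_L_half[of i j k] commutes_L_half_L_half[of j i k] commutes_sym
    by (cases i j rule: linorder_cases) auto
  show "pairwise commutes ({L k i |i. i \<le> k} \<union> {L_half k i |i. i + 1 \<le> k})"
  proof (rule pairwiseI)
    fix x y assume "x \<in> {L k i |i. i \<le> k} \<union> {L_half k i |i. i + 1 \<le> k}"
      "y \<in> {L k i |i. i \<le> k} \<union> {L_half k i |i. i + 1 \<le> k}" and ne: "x \<noteq> y"
    then consider i j where "x = L k i" "y = L k j" "i \<le> k" "j \<le> k"
      | i j where "x = L k i" "y = L_half k j" "i \<le> k" "j < k"
      | i j where "x = L_half k i" "y = L k j" "i < k" "j \<le> k"
      | i j where "x = L_half k i" "y = L_half k j" "i < k" "j < k"
      by fastforce
    then show "commutes x y"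
    proof cases
      case 1
      then show ?thesis using ne LL by blast
    next
      case 2
      then show ?thesis using commutes_L_L_half by blast
    next
      case 3
      then show ?thesis using commutes_L_L_half commutes_sym by blast
    next
      case 4
      then show ?thesis using ne hh by blast
    qed
  qed
qed

end
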